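(* Let $F$ be a field, $A$ a finite subset of $\mathbb N$, $\mathcal A=F\Pi_A$, and let $Q\in\Pi_A^<$ and $k\in\mathbb N_0=\{0,1,2,\ldots\}$. Then $$\mathrm{rad}^{(k)}_{\mathcal A}\Lambda_Q=\sum_{\substack{R\in\Pi_A,\ Q\preceq R\\ \ell(Q)-\ell(R)\ge k}}e_R\wedge\Lambda_Q=\mathrm{rad}^{(k+1)}_{\mathcal A}\Lambda_Q\ \oplus\bigoplus_{\substack{T\in\Pi_A^<,\ Q\preceq T\\ \ell(Q)-\ell(T)=k}}e_T\wedge\Lambda_Q.$$
   Context: For a finite subset $A$ of $\mathbb N=\{1,2,\ldots\}$, a set composition of $A$ is a tuple $P=(P_1,\ldots,P_l)$ of mutually disjoint non-empty subsets of $A$ with union $A$; its length is $\ell(P)=l$; $\Pi_A$ is the set of all set compositions of $A$ ($\Pi_\emptyset$ consists of the empty tuple). $F\Pi_A$ is the $F$-vector space with basis $\Pi_A$, an associative algebra with identity under the bilinear product $(P_1,\ldots,P_l)\wedge(Q_1,\ldots,Q_k)=(P_1\cap Q_1,\ldots,P_1\cap Q_k,\ldots,P_l\cap Q_1,\ldots,P_l\cap Q_k)$ with empty sets deleted. On $\bigoplus_AF\Pi_A$ (over all finite $A\subset\mathbb N$), $\vee$ is the bilinear product with $P\vee Q=(P_1,\ldots,P_l,Q_1,\ldots,Q_k)$ for $P\in\Pi_A$, $Q\in\Pi_B$, $A\cap B=\emptyset$, and $P\vee Q=0$ if $A\cap B\ne\emptyset$. For non-empty finite $B$: $e_B=\sum_P(-1)^{\ell(P)-1}P$,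 the sum over all $P=(P_1,\ldots,P_l)\in\Pi_B$ with $\min B\in P_1$. For $Q=(Q_1,\ldots,Q_k)\in\Pi_A$, $e_Q=e_{Q_1}\vee\cdots\vee e_{Q_k}$ (the empty tuple if $k=0$), and $\Lambda_Q=F\Pi_A\wedge e_Q$, a left ideal of $F\Pi_A$. $\Pi_A^<=\{(Q_1,\ldots,Q_k)\in\Pi_A\mid\min Q_1<\cdots<\min Q_k\}$. For $P,Q\in\Pi_A$, $Q\preceq P$ means that each component of $Q$ is contained in a component of $P$. For a finite-dimensional algebra $\mathcal A$ and a left $\mathcal A$-module $M$, $\mathrm{rad}_{\mathcal A}M$ is the intersection of all maximal submodules of $M$; $\mathrm{rad}^{(0)}_{\mathcal A}M=M$ and $\mathrm{rad}^{(k+1)}_{\mathcal A}M=\mathrm{rad}_{\mathcal A}(\mathrm{rad}^{(k)}_{\mathcal A}M)=(\mathrm{rad}\,\mathcal A)\,\mathrm{rad}^{(k)}_{\mathcal A}M$, with $\mathrm{rad}\,\mathcal A$ the Jacobson radical. *)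

theory Defs
  imports "HOL-Library.Poly_Mapping" "HOL-Library.Disjoint_Sets" "HOL-Library.Set_Algebras"
begin

section \<open>Set compositions\<close>

text \<open>
  A set composition is an ordered set partition, represented by the list of its components.
  As the components are non-empty, distinctness of the list together with disjointness of its
  set of entries says that components at different positions are disjoint.
\<close>

definition set_compositions :: "nat set \<Rightarrow> nat set list set" where
  "set_compositions A = {P. distinct P \<and> partition_on A (set P)}"

definition ordered_set_compositions :: "nat set \<Rightarrow> nat set list set" where
  "ordered_set_compositions A = {P \<in> set_compositions A. sorted_wrt (<) (map Min P)}"

definition refines :: "nat set list \<Rightarrow> nat set list \<Rightarrow> bool"  (infix \<open>\<preceq>\<close> 50) where
  "Q \<preceq> P \<longleftrightarrow> (\<forall>X \<in> set Q. \<exists>Y \<in> set P. X \<subseteq> Y)"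

definition meet_comp :: "nat set list \<Rightarrow> nat set list \<Rightarrow> nat set list" where
  "meet_comp P Q = [X \<inter> Y. X \<leftarrow> P, Y \<leftarrow> Q, X \<inter> Y \<noteq> {}]"

lemma finite_set_compositions:
  assumes "finite A"
  shows "finite (set_compositions A)"
proof (rule finite_subset)
  show "set_compositions A \<subseteq> {P. set P \<subseteq> Pow A \<and> distinct P}"
    by (auto simp: set_compositions_def partition_on_def)
  show "finite {P. set P \<subseteq> Pow A \<and> distinct P}"
    using assms by (intro finite_subset_distinct) simp
qed


section \<open>Linear combinations of set compositions\<close>

text \<open>
  Formal linear combinations are finitely supported functions on lists of sets. The direct sum of
  all the spaces \<open>comp_algebra A\<close> sits inside this type. Both products are the bilinear extensions
  of the products of basis elements; they are meant to be applied to linear combinations of set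
  compositions only.
\<close>

definition comp_algebra :: "nat set \<Rightarrow> (nat set list \<Rightarrow>\<^sub>0 'f::field) set" where
  "comp_algebra A = {p. Poly_Mapping.keys p \<subseteq> set_compositions A}"

definition wedge ::
    "(nat set list \<Rightarrow>\<^sub>0 'f::field) \<Rightarrow> (nat set list \<Rightarrow>\<^sub>0 'f) \<Rightarrow> (nat set list \<Rightarrow>\<^sub>0 'f)"
    (infixl \<open>\<curlywedge>\<close> 70) where
  "p \<curlywedge> q = (\<Sum>P \<in> Poly_Mapping.keys p. \<Sum>Q \<in> Poly_Mapping.keys q.
     Poly_Mapping.single (meet_comp P Q) (Poly_Mapping.lookup p P * Poly_Mapping.lookup q Q))"

definition vee ::
    "(nat set list \<Rightarrow>\<^sub>0 'f::field) \<Rightarrow> (nat set list \<Rightarrow>\<^sub>0 'f) \<Rightarrow> (nat set list \<Rightarrow>\<^sub>0 'f)"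
    (infixr \<open>\<curlyvee>\<close> 65) where
  "p \<curlyvee> q = (\<Sum>P \<in> Poly_Mapping.keys p. \<Sum>Q \<in> Poly_Mapping.keys q.
     if \<Union>(set P) \<inter> \<Union>(set Q) = {}
     then Poly_Mapping.single (P @ Q) (Poly_Mapping.lookup p P * Poly_Mapping.lookup q Q)
     else 0)"

definition e_set :: "nat set \<Rightarrow> (nat set list \<Rightarrow>\<^sub>0 'f::field)" where
  "e_set B = (\<Sum>P | P \<in> set_compositions B \<and> Min B \<in> hd P.
     Poly_Mapping.single P ((- 1) ^ (length P - 1)))"

text \<open>The empty tuple is the identity for \<open>\<curlyvee>\<close>, so it may end the iterated product.\<close>

definition e_comp :: "nat set list \<Rightarrow> (nat set list \<Rightarrow>\<^sub>0 'f::field)" where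
  "e_comp Q = foldr (\<lambda>B p. e_set B \<curlyvee> p) Q (Poly_Mapping.single [] 1)"

definition Lam :: "nat set \<Rightarrow> nat set list \<Rightarrow> (nat set list \<Rightarrow>\<^sub>0 'f::field) set" where
  "Lam A Q = {p \<curlywedge> e_comp Q | p. p \<in> comp_algebra A}"


section \<open>Radicals of modules and direct sums\<close>

text \<open>
  \<open>R\<close> is the carrier of an algebra with identity, acting by \<open>act\<close> on a module with carrier \<open>M\<close>.
  Scalars act through the multiples of the identity in \<open>R\<close>, so closure under scalar
  multiplication is part of closure under the action.
\<close>

definition is_submodule ::
    "('r \<Rightarrow> 'm \<Rightarrow> 'm) \<Rightarrow> 'r set \<Rightarrow> 'm::ab_group_add set \<Rightarrow> 'm set \<Rightarrow> bool" where
  "is_submodule act R M N \<longleftrightarrow>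
     N \<subseteq> M \<and> 0 \<in> N \<and> (\<forall>x\<in>N. \<forall>y\<in>N. x - y \<in> N) \<and> (\<forall>r\<in>R. \<forall>x\<in>N. act r x \<in> N)"

definition is_maximal_submodule ::
    "('r \<Rightarrow> 'm \<Rightarrow> 'm) \<Rightarrow> 'r set \<Rightarrow> 'm::ab_group_add set \<Rightarrow> 'm set \<Rightarrow> bool" where
  "is_maximal_submodule act R M N \<longleftrightarrow>
     is_submodule act R M N \<and> N \<noteq> M \<and>
     (\<forall>L. is_submodule act R M L \<and> N \<subseteq> L \<longrightarrow> L = N \<or> L = M)"

text \<open>
  Intersecting with \<open>M\<close> fixes the value for modules without maximal submodules; in particular the
  zero module is its own radical.
\<close>

definition module_rad ::
    "('r \<Rightarrow> 'm \<Rightarrow> 'm) \<Rightarrow> 'r set \<Rightarrow> 'm::ab_group_add set \<Rightarrow> 'm set" where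
  "module_rad act R M = M \<inter> \<Inter>{N. is_maximal_submodule act R M N}"

definition module_rad_iter ::
    "('r \<Rightarrow> 'm \<Rightarrow> 'm) \<Rightarrow> 'r set \<Rightarrow> nat \<Rightarrow> 'm::ab_group_add set \<Rightarrow> 'm set" where
  "module_rad_iter act R k M = (module_rad act R ^^ k) M"

text \<open>
  Sums of subspaces are the pointwise sums of \<open>HOL-Library.Set_Algebras\<close>; the empty sum is \<open>{0}\<close>.
\<close>

definition is_direct_sum :: "'i set \<Rightarrow> ('i \<Rightarrow> 'm::ab_group_add set) \<Rightarrow> 'm set \<Rightarrow> bool" where
  "is_direct_sum I S M \<longleftrightarrow>
     finite I \<and> M = (\<Sum>i\<in>I. S i) \<and>
     (\<forall>x. (\<forall>i\<in>I. x i \<in> S i) \<and> (\<Sum>i\<in>I. x i) = 0 \<longrightarrow> (\<forall>i\<in>I. x i = 0))"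

end

theory Submission
  imports Defs "HOL-Library.FuncSet" Complex_Main
begin

text \<open>
  A set composition \<open>P\<close> acts on the generator of \<open>Lam A Q\<close> by rearrangement: \<open>P\<close> sends \<open>e_comp Q\<close>
  to \<open>e_comp (meet_comp P Q)\<close> if \<open>Q \<preceq> P\<close>, and to \<open>0\<close> otherwise (\<open>basis_wedge_e_comp\<close>). So \<open>Lam A Q\<close>
  is spanned by the elements \<open>e_comp Q'\<close> with \<open>Q'\<close> a rearrangement of \<open>Q\<close>. It behaves like the
  multilinear part of the free associative algebra whose letters are the components of \<open>Q\<close>, and
  \<open>e_comp R\<close> maps it onto the products of one Lie polynomial for each component of \<open>R\<close>. The
  filtration in the theorem is the one that the Poincare-Birkhoff-Witt theorem considers, by the
  number of Lie factors.

  The elements \<open>e_comp T\<close> with \<open>T\<close> in \<open>ordered_set_compositions A\<close> are orthogonal idempotents with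
  sum \<open>1\<close> (\<open>e_comp_orthogonal\<close>, \<open>sum_e_comp_ordered\<close>): in a product of two different ones, either
  the second composition does not refine the first, or some Lie projection meets a product of at
  least two letters with the least one in front, and such products are killed. Therefore \<open>Lam A Q\<close>
  is the direct sum of the spaces \<open>e_comp T \<curlywedge> Lam A Q\<close>. Write \<open>n\<close> for the length of \<open>Q\<close>, and let
  \<open>layer A Q j\<close> be the sum of those with \<open>length T + j \<le> n\<close>. Both descriptions of the layers in the
  theorem, as a sum over all \<open>R\<close> and as a direct sum over ordered \<open>T\<close>, come from orthogonality and
  from the fact that \<open>e_comp T \<curlywedge> e_comp R = 0\<close> unless \<open>R \<preceq> T\<close>.

  It remains to see that the radical of a layer is the next one. If \<open>T\<close> has length \<open>n - j\<close>, then
  \<open>e_comp T \<curlywedge> (P \<curlywedge> m)\<close> is \<open>e_comp T \<curlywedge> m\<close> or \<open>0\<close> for all \<open>m\<close> in \<open>layer A Q j\<close>, according to whether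
  \<open>T \<preceq> P\<close> (\<open>e_comp_wedge_basis_wedge_layer\<close>). So every coordinate of \<open>e_comp T \<curlywedge> m\<close> is a linear
  form on the layer whose kernel is a submodule, and these kernels intersect in the next layer. For
  the other inclusion consider differences \<open>P - P'\<close> of two set compositions with the same
  components. By the same formula they map every layer into the next one, and they generate the
  next layer, because every Lie polynomial of degree at least two is a sum of commutators
  (\<open>e_comp_wedge_bracket\<close>, \<open>next_layer_generated\<close>). As the layers are \<open>0\<close> eventually, a maximal
  submodule \<open>N\<close> of \<open>layer A Q j\<close> satisfies \<open>N + layer A Q (j + i) = layer A Q j\<close> and
  \<open>layer A Q (j + i + 1) \<subseteq> N\<close> for some \<open>i\<close>. Hence every \<open>P - P'\<close> maps \<open>layer A Q j\<close> into \<open>N\<close>, and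
  \<open>N\<close> contains \<open>layer A Q (j + 1)\<close>.
\<close>

section \<open>The two products as bilinear maps\<close>

type_synonym 'f comb = "nat set list \<Rightarrow>\<^sub>0 'f"

definition scale :: "'f::field \<Rightarrow> 'f comb \<Rightarrow> 'f comb" where
  "scale c = Poly_Mapping.map ((*) c)"

lemma lookup_scale [simp]: "Poly_Mapping.lookup (scale c p) P = c * Poly_Mapping.lookup p P"
  by (auto simp: scale_def map.rep_eq when_def)

interpretation comb: vector_space "scale :: 'f::field \<Rightarrow> 'f comb \<Rightarrow> 'f comb"
  by unfold_locales (auto intro!: poly_mapping_eqI simp: lookup_add algebra_simps)

lemma scale_single: "scale c (Poly_Mapping.single P a) = Poly_Mapping.single P (c * a)"
  by (auto intro!: poly_mapping_eqI simp: lookup_single when_def)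

abbreviation basis :: "nat set list \<Rightarrow> 'f::field comb" where
  "basis P \<equiv> Poly_Mapping.single P 1"

text \<open>
  Both products are extensions of products of basis elements, so bilinearity is proved once for an
  arbitrary such product \<open>b\<close>.
\<close>

definition bilinear_extension ::
    "(nat set list \<Rightarrow> nat set list \<Rightarrow> 'f comb) \<Rightarrow> 'f::field comb \<Rightarrow> 'f comb \<Rightarrow> 'f comb" where
  "bilinear_extension b p q = (\<Sum>P \<in> Poly_Mapping.keys p. \<Sum>Q \<in> Poly_Mapping.keys q.
     scale (Poly_Mapping.lookup p P * Poly_Mapping.lookup q Q) (b P Q))"

lemma bilinear_extension_superset:
  assumes "finite S" "finite S'" "Poly_Mapping.keys p \<subseteq> S" "Poly_Mapping.keys q \<subseteq> S'"
  shows "bilinear_extension b p q = (\<Sum>P \<in> S. \<Sum>Q \<in> S'.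
     scale (Poly_Mapping.lookup p P * Poly_Mapping.lookup q Q) (b P Q))"
proof -
  have "(\<Sum>Q \<in> Poly_Mapping.keys q. scale (Poly_Mapping.lookup p P * Poly_Mapping.lookup q Q) (b P Q))
      = (\<Sum>Q \<in> S'. scale (Poly_Mapping.lookup p P * Poly_Mapping.lookup q Q) (b P Q))" for P
    using assms by (intro sum.mono_neutral_left) (auto simp: in_keys_iff)
  then have "bilinear_extension b p q = (\<Sum>P \<in> Poly_Mapping.keys p. \<Sum>Q \<in> S'.
     scale (Poly_Mapping.lookup p P * Poly_Mapping.lookup q Q) (b P Q))"
    by (simp add: bilinear_extension_def)
  also have "\<dots> = (\<Sum>P \<in> S. \<Sum>Q \<in> S'.
     scale (Poly_Mapping.lookup p P * Poly_Mapping.lookup q Q) (b P Q))"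
    using assms by (intro sum.mono_neutral_left) (auto simp: in_keys_iff)
  finally show ?thesis .
qed

lemma bilinear_extension_add_left:
  "bilinear_extension b (p + p') q = bilinear_extension b p q + bilinear_extension b p' q"
proof -
  let ?S = "Poly_Mapping.keys p \<union> Poly_Mapping.keys p'" and ?S' = "Poly_Mapping.keys q"
  have *: "bilinear_extension b r q = (\<Sum>P \<in> ?S. \<Sum>Q \<in> ?S'.
     scale (Poly_Mapping.lookup r P * Poly_Mapping.lookup q Q) (b P Q))"
    if "Poly_Mapping.keys r \<subseteq> ?S" for r
    using that by (intro bilinear_extension_superset) auto
  have "Poly_Mapping.keys (p + p') \<subseteq> ?S"
    by (rule keys_add)
  then show ?thesis
    by (simp add: * lookup_add algebra_simps comb.scale_left_distrib sum.distrib)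
qed

lemma bilinear_extension_add_right:
  "bilinear_extension b p (q + q') = bilinear_extension b p q + bilinear_extension b p q'"
proof -
  let ?S = "Poly_Mapping.keys p" and ?S' = "Poly_Mapping.keys q \<union> Poly_Mapping.keys q'"
  have *: "bilinear_extension b p r = (\<Sum>P \<in> ?S. \<Sum>Q \<in> ?S'.
     scale (Poly_Mapping.lookup p P * Poly_Mapping.lookup r Q) (b P Q))"
    if "Poly_Mapping.keys r \<subseteq> ?S'" for r
    using that by (intro bilinear_extension_superset) auto
  have "Poly_Mapping.keys (q + q') \<subseteq> ?S'"
    by (rule keys_add)
  then show ?thesis
    by (simp add: * lookup_add algebra_simps comb.scale_left_distrib sum.distrib)
qed

lemma keys_scale: "Poly_Mapping.keys (scale c p) \<subseteq> Poly_Mapping.keys p"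
  by (auto simp: in_keys_iff)

lemma bilinear_extension_scale_left:
  "bilinear_extension b (scale c p) q = scale c (bilinear_extension b p q)"
  by (subst bilinear_extension_superset[OF _ _ keys_scale order.refl])
     (auto simp: bilinear_extension_def comb.scale_sum_right mult.assoc)

lemma bilinear_extension_scale_right:
  "bilinear_extension b p (scale c q) = scale c (bilinear_extension b p q)"
  by (subst bilinear_extension_superset[OF _ _ order.refl keys_scale])
     (auto simp: bilinear_extension_def comb.scale_sum_right mult_ac)

lemma bilinear_extension_basis:
  "bilinear_extension b (Poly_Mapping.single P c) (Poly_Mapping.single Q d) = scale (c * d) (b P Q)"
  by (auto simp: bilinear_extension_def)

lemma wedge_bilinear: "wedge = bilinear_extension (\<lambda>P Q. basis (meet_comp P Q))"
  by (intro ext) (simp add: wedge_def bilinear_extension_def scale_single)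

lemma vee_bilinear: "vee = bilinear_extension
    (\<lambda>P Q. if \<Union>(set P) \<inter> \<Union>(set Q) = {} then basis (P @ Q) else 0)"
  by (intro ext) (auto simp: vee_def bilinear_extension_def scale_single intro!: sum.cong)


lemma module_hom_bilinear_extension_left:
  "module_hom scale scale (\<lambda>p. bilinear_extension b p q)"
  by unfold_locales (simp_all add: bilinear_extension_add_left bilinear_extension_scale_left)

lemma module_hom_bilinear_extension_right: "module_hom scale scale (bilinear_extension b p)"
  by unfold_locales (simp_all add: bilinear_extension_add_right bilinear_extension_scale_right)

interpretation wedge_left: module_hom scale scale "\<lambda>p. p \<curlywedge> q" for q :: "'f::field comb"
  unfolding wedge_bilinear by (rule module_hom_bilinear_extension_left)

interpretation wedge_right: module_hom scale scale "\<lambda>q. p \<curlywedge> q" for p :: "'f::field comb"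
  unfolding wedge_bilinear by (rule module_hom_bilinear_extension_right)

interpretation vee_left: module_hom scale scale "\<lambda>p. p \<curlyvee> q" for q :: "'f::field comb"
  unfolding vee_bilinear by (rule module_hom_bilinear_extension_left)

interpretation vee_right: module_hom scale scale "\<lambda>q. p \<curlyvee> q" for p :: "'f::field comb"
  unfolding vee_bilinear by (rule module_hom_bilinear_extension_right)

lemmas wedge_linear = wedge_left.sum wedge_right.sum wedge_left.scale wedge_right.scale

lemmas vee_linear = vee_left.sum vee_right.sum vee_left.scale vee_right.scale

declare wedge_left.zero [simp] wedge_right.zero [simp] vee_left.zero [simp] vee_right.zero [simp]

lemma basis_wedge_basis [simp]:
  "basis P \<curlywedge> basis Q = (basis (meet_comp P Q) :: 'f::field comb)"
  by (simp add: wedge_bilinear bilinear_extension_basis)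

lemma basis_vee_basis: "basis P \<curlyvee> basis Q =
    (if \<Union>(set P) \<inter> \<Union>(set Q) = {} then basis (P @ Q) else 0 :: 'f::field comb)"
  by (simp add: vee_bilinear bilinear_extension_basis)

lemma comb_induct_on [consumes 1, case_names zero add scale basis]:
  fixes p :: "'f::field comb"
  assumes "Poly_Mapping.keys p \<subseteq> S"
    and "Pr 0" and "\<And>p q. Pr p \<Longrightarrow> Pr q \<Longrightarrow> Pr (p + q)" and "\<And>c p. Pr p \<Longrightarrow> Pr (scale c p)"
    and "\<And>P. P \<in> S \<Longrightarrow> Pr (basis P)"
  shows "Pr p"
proof -
  have "p = (\<Sum>P \<in> Poly_Mapping.keys p. scale (Poly_Mapping.lookup p P) (basis P))"
    by (rule poly_mapping_eqI)
       (auto simp: lookup_sum lookup_single when_def if_distrib in_keys_iff cong: if_cong)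
  moreover have "Pr (\<Sum>P \<in> T. scale (Poly_Mapping.lookup p P) (basis P))"
    if "finite T" "T \<subseteq> S" for T
    using that
  proof (induction T rule: finite_induct)
    case empty
    then show ?case using assms(2) by simp
  next
    case (insert P T)
    then show ?case
      unfolding sum.insert[OF insert.hyps] by (intro assms(3) assms(4) assms(5)) auto
  qed
  ultimately show ?thesis
    using assms(1) by (metis finite_keys)
qed

lemma comb_induct [case_names zero add scale basis]:
  fixes p :: "'f::field comb"
  assumes "Pr 0" and "\<And>p q. Pr p \<Longrightarrow> Pr q \<Longrightarrow> Pr (p + q)" and "\<And>c p. Pr p \<Longrightarrow> Pr (scale c p)"
    and "\<And>P. Pr (basis P)"
  shows "Pr p"
  by (rule comb_induct_on[of p UNIV]) (rule subset_UNIV assms | assumption)+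

section \<open>Set compositions and their product\<close>

text \<open>
  The product \<open>meet_comp P Q\<close> concatenates the traces of \<open>Q\<close> on the components of \<open>P\<close>. Identities
  between products are therefore checked one component of \<open>P\<close> at a time.
\<close>

definition trace_on :: "nat set \<Rightarrow> nat set list \<Rightarrow> nat set list" where
  "trace_on X Q = filter (\<lambda>Y. Y \<noteq> {}) (map ((\<inter>) X) Q)"

lemma trace_on_simps [simp]:
  "trace_on X [] = []"
  "trace_on X (Y # Q) = (if X \<inter> Y = {} then trace_on X Q else (X \<inter> Y) # trace_on X Q)"
  "trace_on X (P @ Q) = trace_on X P @ trace_on X Q"
  by (auto simp: trace_on_def)

lemma meet_comp_simps [simp]:
  "meet_comp [] Q = []"
  "meet_comp (X # P) Q = trace_on X Q @ meet_comp P Q"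
  "meet_comp (P @ P') Q = meet_comp P Q @ meet_comp P' Q"
proof -
  show "meet_comp (X # P) Q = trace_on X Q @ meet_comp P Q" for X P
    by (induction Q) (auto simp: meet_comp_def)
qed (simp_all add: meet_comp_def)

lemma trace_on_trace_on: "trace_on X (trace_on Y Q) = trace_on (X \<inter> Y) Q"
  by (induction Q) (auto simp: Int_assoc)

lemma trace_on_empty [simp]: "trace_on {} Q = []"
  by (induction Q) auto

lemma trace_on_meet_comp: "trace_on X (meet_comp P Q) = meet_comp (trace_on X P) Q"
  by (induction P) (auto simp: trace_on_trace_on)

lemma meet_comp_assoc: "meet_comp (meet_comp P Q) R = meet_comp P (meet_comp Q R)"
  by (induction P) (auto simp: trace_on_meet_comp)

lemma wedge_assoc: "p \<curlywedge> q \<curlywedge> r = p \<curlywedge> (q \<curlywedge> (r :: 'f::field comb))"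
proof (induction p rule: comb_induct)
  case (basis P)
  show ?case
  proof (induction q rule: comb_induct)
    case (basis Q)
    show ?case
      by (induction r rule: comb_induct)
        (auto simp: wedge_left.add wedge_right.add wedge_linear meet_comp_assoc)
  qed (auto simp: wedge_left.add wedge_right.add wedge_linear)
qed (auto simp: wedge_left.add wedge_right.add wedge_linear)

lemma vee_assoc: "(p \<curlyvee> q) \<curlyvee> r = p \<curlyvee> q \<curlyvee> (r :: 'f::field comb)"
proof (induction p rule: comb_induct)
  case (basis P)
  show ?case
  proof (induction q rule: comb_induct)
    case (basis Q)
    show ?case
    proof (induction r rule: comb_induct)
      case (basis R)
      show ?case
        by (simp add: basis_vee_basis Int_Un_distrib Int_Un_distrib2)
    qed (simp_all add: vee_right.add vee_linear)
  qed (auto simp: vee_left.add vee_right.add vee_linear)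
qed (auto simp: vee_left.add vee_right.add vee_linear)

lemma vee_Nil [simp]: "basis [] \<curlyvee> p = p" "p \<curlyvee> basis [] = (p :: 'f::field comb)"
proof -
  show "basis [] \<curlyvee> p = p"
    by (induction p rule: comb_induct)
      (auto simp: vee_right.add vee_right.scale basis_vee_basis)
  show "p \<curlyvee> basis [] = p"
    by (induction p rule: comb_induct)
      (auto simp: vee_left.add vee_left.scale basis_vee_basis)
qed

text \<open>
  Disjointness as a relation between earlier and later entries splits along \<open>#\<close>, \<open>@\<close> and \<open>rev\<close>,
  which \<open>disjoint (set P)\<close> does not.
\<close>

lemma set_compositions_iff: "P \<in> set_compositions A \<longleftrightarrow>
    {} \<notin> set P \<and> sorted_wrt (\<lambda>X Y. X \<inter> Y = {}) P \<and> \<Union>(set P) = A"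
proof -
  have "distinct P \<and> disjoint (set P) \<longleftrightarrow> sorted_wrt (\<lambda>X Y. X \<inter> Y = {}) P" if "{} \<notin> set P"
    using that
  proof (induction P)
    case (Cons X P)
    have "distinct (X # P) \<and> disjoint (set (X # P)) \<longleftrightarrow>
        (\<forall>Y \<in> set P. X \<inter> Y = {}) \<and> distinct P \<and> disjoint (set P)"
    proof
      assume "distinct (X # P) \<and> disjoint (set (X # P))"
      then show "(\<forall>Y \<in> set P. X \<inter> Y = {}) \<and> distinct P \<and> disjoint (set P)"
        unfolding disjoint_def by fastforce
    next
      assume *: "(\<forall>Y \<in> set P. X \<inter> Y = {}) \<and> distinct P \<and> disjoint (set P)"
      moreover have "X \<notin> set P"
        using * Cons.prems by fastforce
      ultimately show "distinct (X # P) \<and> disjoint (set (X # P))"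
        unfolding disjoint_def by (simp add: Int_commute)
    qed
    with Cons show ?case
      by simp
  qed (auto simp: disjoint_def)
  then show ?thesis
    by (auto simp: set_compositions_def partition_on_def)
qed

lemma trace_on_cong:
  "(\<And>Y. Y \<in> set Q \<Longrightarrow> X \<inter> Y = X' \<inter> Y) \<Longrightarrow> trace_on X Q = trace_on X' Q"
  by (induction Q) auto

lemma trace_on_disjoint: "(\<And>Y. Y \<in> set Q \<Longrightarrow> X \<inter> Y = {}) \<Longrightarrow> trace_on X Q = []"
  by (induction Q) auto

lemma set_trace_on: "set (trace_on X Q) = {X \<inter> Y | Y. Y \<in> set Q \<and> X \<inter> Y \<noteq> {}}"
  by (auto simp: trace_on_def)

lemma set_meet_comp:
  "set (meet_comp P Q) = {X \<inter> Y | X Y. X \<in> set P \<and> Y \<in> set Q \<and> X \<inter> Y \<noteq> {}}"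
proof -
  have "set (meet_comp P Q) = (\<Union>X \<in> set P. set (trace_on X Q))"
    by (induction P) auto
  then show ?thesis
    by (simp add: set_trace_on) blast
qed

lemma meet_comp_cong:
  "(\<And>X. X \<in> set P \<Longrightarrow> trace_on X Q = trace_on X Q') \<Longrightarrow> meet_comp P Q = meet_comp P Q'"
  by (induction P) auto

lemma sorted_wrt_trace_on:
  "sorted_wrt (\<lambda>X Y. X \<inter> Y = {}) Q \<Longrightarrow> sorted_wrt (\<lambda>X Y. X \<inter> Y = {}) (trace_on X Q)"
  by (induction Q) (auto simp: set_trace_on)

lemma meet_comp_in_set_compositions:
  assumes "P \<in> set_compositions A" "Q \<in> set_compositions A'"
  shows "meet_comp P Q \<in> set_compositions (A \<inter> A')"
proof -
  have "sorted_wrt (\<lambda>X Y. X \<inter> Y = {}) (meet_comp P Q)"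
    if "sorted_wrt (\<lambda>X Y. X \<inter> Y = {}) P" "sorted_wrt (\<lambda>X Y. X \<inter> Y = {}) Q"
    using that
  proof (induction P)
    case (Cons X P)
    then have "X' \<inter> Y' = {}" if "X' \<in> set (trace_on X Q)" "Y' \<in> set (meet_comp P Q)" for X' Y'
      using that by (fastforce simp: set_trace_on set_meet_comp)
    with Cons show ?case
      by (simp add: sorted_wrt_append sorted_wrt_trace_on)
  qed simp
  moreover have "\<Union>(set (meet_comp P Q)) = \<Union>(set P) \<inter> \<Union>(set Q)"
    unfolding set_meet_comp by blast
  moreover have "{} \<notin> set (meet_comp P Q)"
    by (auto simp: set_meet_comp)
  ultimately show ?thesis
    using assms by (simp add: set_compositions_iff)
qed

lemma disjoint_blocks:
  assumes "P \<in> set_compositions A" "X \<in> set P" "Y \<in> set P" "X \<noteq> Y"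
  shows "X \<inter> Y = {}"
  using assms by (auto simp: set_compositions_def partition_on_def disjoint_def)

lemma refines_dichotomy:
  assumes "P \<in> set_compositions A" "Q \<preceq> P" "X \<in> set P" "B \<in> set Q"
  shows "B \<subseteq> X \<or> B \<inter> X = {}"
  using assms disjoint_blocks[OF assms(1)] unfolding refines_def by blast

text \<open>
  Refinement can be read off from the product. Whatever leaves \<open>meet_comp P Q\<close> unchanged therefore
  also preserves \<open>Q \<preceq> P\<close>.
\<close>

lemma refines_iff_meet_comp:
  assumes "P \<in> set_compositions A" "Q \<in> set_compositions A"
  shows "Q \<preceq> P \<longleftrightarrow> set (meet_comp P Q) = set Q"
proof
  assume ref: "Q \<preceq> P"
  show "set (meet_comp P Q) = set Q"
  proof (intro set_eqI iffI)
    fix Z assume "Z \<in> set (meet_comp P Q)"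
    then obtain X Y where "X \<in> set P" "Y \<in> set Q" "Z = X \<inter> Y" "X \<inter> Y \<noteq> {}"
      by (auto simp: set_meet_comp)
    with refines_dichotomy[OF assms(1) ref, of X Y] show "Z \<in> set Q"
      by (auto simp: Int_absorb1 Int_commute)
  next
    fix Z assume "Z \<in> set Q"
    moreover from this ref obtain X where "X \<in> set P" "Z \<subseteq> X"
      by (auto simp: refines_def)
    moreover have "Z \<noteq> {}"
      using \<open>Z \<in> set Q\<close> assms(2) by (auto simp: set_compositions_iff)
    ultimately show "Z \<in> set (meet_comp P Q)"
      unfolding set_meet_comp by (metis (mono_tags, lifting) Int_absorb1 mem_Collect_eq)
  qed
next
  assume *: "set (meet_comp P Q) = set Q"
  show "Q \<preceq> P"
    unfolding refines_def
  proof
    fix Z assume "Z \<in> set Q"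
    then have "Z \<in> set (meet_comp P Q)" by (simp add: *)
    then show "\<exists>Y \<in> set P. Z \<subseteq> Y" by (auto simp: set_meet_comp)
  qed
qed

lemma refines_block: "Q \<preceq> P \<Longrightarrow> Y \<in> set Q \<Longrightarrow> \<exists>Z \<in> set P. Y \<subseteq> Z"
  by (simp add: refines_def)

section \<open>Expansion of the elements \<open>e_comp Q\<close>\<close>

definition block_sign :: "nat set list \<Rightarrow> 'f::field" where
  "block_sign P = (- 1) ^ (length P - 1)"

definition anchored :: "nat set \<Rightarrow> nat set list set" where
  "anchored B = {P \<in> set_compositions B. Min B \<in> hd P}"

lemma e_set_eq: "e_set B = (\<Sum>P \<in> anchored B. scale (block_sign P) (basis P))"
  by (simp add: e_set_def anchored_def block_sign_def scale_single)

lemma finite_anchored: "finite B \<Longrightarrow> finite (anchored B)"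
  by (simp add: anchored_def finite_set_compositions)

lemma e_comp_Nil [simp]: "e_comp [] = basis []"
  by (simp add: e_comp_def)

lemma e_comp_Cons: "e_comp (B # Q) = e_set B \<curlyvee> e_comp Q"
  by (simp add: e_comp_def)

lemma e_comp_append: "e_comp (P @ Q) = e_comp P \<curlyvee> (e_comp Q :: 'f::field comb)"
  by (induction P) (auto simp: e_comp_Cons vee_assoc)

lemma e_comp_singleton [simp]: "e_comp [B] = e_set B"
  by (simp add: e_comp_Cons)

text \<open>
  Multiplying out \<open>e_comp Q\<close> means choosing one term of every factor. The choices are functions on
  the set of components, not lists, so that a rearrangement of \<open>Q\<close> has the same choices with the
  same coefficients.
\<close>

abbreviation choices :: "nat set list \<Rightarrow> (nat set \<Rightarrow> nat set list) set" where
  "choices Q \<equiv> (\<Pi>\<^sub>E B \<in> set Q. anchored B)"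

definition glue :: "nat set list \<Rightarrow> (nat set \<Rightarrow> nat set list) \<Rightarrow> nat set list" where
  "glue Q \<phi> = concat (map \<phi> Q)"

lemma Union_glue:
  assumes "\<phi> \<in> choices Q"
  shows "\<Union>(set (glue Q \<phi>)) = \<Union>(set Q)"
proof -
  have "\<Union>(set (\<phi> B)) = B" if "B \<in> set Q" for B
  proof -
    have "\<phi> B \<in> anchored B"
      using assms that by (rule PiE_mem)
    then show ?thesis
      by (simp add: anchored_def set_compositions_iff)
  qed
  moreover have "\<Union>(set (glue Q \<phi>)) = (\<Union>B \<in> set Q. \<Union>(set (\<phi> B)))"
    by (auto simp: glue_def)
  ultimately show ?thesis by simp
qed

lemma e_comp_expansion:
  assumes "Q \<in> set_compositions A" "finite A"
  shows "e_comp Q =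
      (\<Sum>\<phi> \<in> choices Q. scale (\<Prod>B \<in> set Q. block_sign (\<phi> B)) (basis (glue Q \<phi>)) :: 'f::field comb)"
  using assms
proof (induction Q arbitrary: A)
  case Nil
  then show ?case by (simp add: glue_def)
next
  case (Cons B Q)
  have Q: "Q \<in> set_compositions (\<Union>(set Q))" "finite (\<Union>(set Q))" "finite B"
    and disj: "B \<inter> \<Union>(set Q) = {}" and "B \<noteq> {}"
    using Cons.prems by (auto simp: set_compositions_iff)
  then have B: "B \<notin> set Q" by auto
  note IH = Cons.IH[OF Q(1,2)]
  have *: "basis Z \<curlyvee> basis (glue Q \<phi>) = (basis (glue (B # Q) (\<phi>(B := Z))) :: 'f comb)"
    if "Z \<in> anchored B" "\<phi> \<in> choices Q" for Z \<phi>
  proof -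
    have "\<Union>(set Z) = B"
      using that by (simp add: anchored_def set_compositions_iff)
    moreover have "glue Q (\<phi>(B := Z)) = glue Q \<phi>"
      using B by (auto simp: glue_def intro!: arg_cong[where f = concat])
    ultimately show ?thesis
      using disj Union_glue[OF that(2)] basis_vee_basis[of Z "glue Q \<phi>"] by (simp add: glue_def)
  qed
  have **: "(\<Prod>C \<in> set (B # Q). block_sign ((\<phi>(B := Z)) C)) =
      (block_sign Z * (\<Prod>C \<in> set Q. block_sign (\<phi> C)) :: 'f)"
    for Z \<phi>
  proof -
    have "(\<Prod>C \<in> set Q. block_sign ((\<phi>(B := Z)) C)) = ((\<Prod>C \<in> set Q. block_sign (\<phi> C)) :: 'f)"
      using B by (intro prod.cong) auto
    then show ?thesis using B by simp
  qed
  have "e_comp (B # Q) = (\<Sum>(Z, \<phi>) \<in> anchored B \<times> choices Q.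
      scale (block_sign Z * (\<Prod>C \<in> set Q. block_sign (\<phi> C))) (basis Z \<curlyvee> basis (glue Q \<phi>)) :: 'f comb)"
    unfolding e_comp_Cons IH e_set_eq vee_left.sum
    by (simp add: vee_linear sum.cartesian_product case_prod_unfold mult.commute)
  also have "\<dots> = (\<Sum>(Z, \<phi>) \<in> anchored B \<times> choices Q.
      scale (\<Prod>C \<in> set (B # Q). block_sign ((\<phi>(B := Z)) C)) (basis (glue (B # Q) (\<phi>(B := Z)))))"
    using * ** by (intro sum.cong) auto
  also have "\<dots> =
      (\<Sum>\<phi> \<in> choices (B # Q). scale (\<Prod>C \<in> set (B # Q). block_sign (\<phi> C)) (basis (glue (B # Q) \<phi>)))"
    using inj_combinator[OF B, of anchored]
    by (simp add: PiE_insert_eq sum.reindex case_prod_unfold o_def)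
  finally show ?case .
qed

section \<open>A sign-reversing involution\<close>

text \<open>
  Let \<open>C\<close> be the first component of \<open>Z\<close> that meets \<open>S\<close>. If \<open>C\<close> is contained in \<open>S\<close>, it is merged
  with the component before it; otherwise it is split into \<open>C - S\<close> and \<open>C \<inter> S\<close>, in this order.
  These two moves undo each other, and they change the length by one as soon as some component
  meets \<open>S\<close>. Merging needs a preceding component, so the first component must not be contained in
  \<open>S\<close>; this holds whenever the minimum lies in the first component and not in \<open>S\<close>.
\<close>

fun toggle :: "nat set \<Rightarrow> nat set list \<Rightarrow> nat set list" where
  "toggle S [] = []"
| "toggle S [C] = (if C \<inter> S = {} then [C] else [C - S, C \<inter> S])"
| "toggle S (C # D # V) =
    (if C \<inter> S \<noteq> {} then (C - S) # (C \<inter> S) # D # V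
     else if D \<subseteq> S then (C \<union> D) # V else C # toggle S (D # V))"

lemma toggle_hd: "x \<in> hd Z \<Longrightarrow> x \<notin> S \<Longrightarrow> x \<in> hd (toggle S Z)"
  by (cases "(S, Z)" rule: toggle.cases) auto

lemma Union_toggle: "\<Union>(set (toggle S Z)) = \<Union>(set Z)"
  by (induction S Z rule: toggle.induct) auto

lemma toggle_in_set_compositions:
  assumes "Z \<in> set_compositions B" "\<not> hd Z \<subseteq> S"
  shows "toggle S Z \<in> set_compositions B"
  using assms
proof (induction S Z arbitrary: B rule: toggle.induct)
  case (3 S C D V)
  show ?case
  proof (cases "C \<inter> S \<noteq> {} \<or> D \<subseteq> S")
    case True
    with 3 show ?thesis
      by (auto simp: set_compositions_iff)
  next
    case False
    have "D # V \<in> set_compositions (\<Union>(set (D # V)))"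
      using 3 by (auto simp: set_compositions_iff)
    with 3 False have "toggle S (D # V) \<in> set_compositions (\<Union>(set (D # V)))"
      by auto
    moreover have "C \<inter> Y = {}" if "Y \<in> set (toggle S (D # V))" for Y
      using Union_toggle[of S "D # V"] that 3(2) by (fastforce simp: set_compositions_iff)
    ultimately show ?thesis
      using 3 False by (auto simp: set_compositions_iff)
  qed
qed (auto simp: set_compositions_iff)

lemma toggle_toggle:
  assumes "Z \<in> set_compositions B" "\<not> hd Z \<subseteq> S"
  shows "toggle S (toggle S Z) = Z"
  using assms
proof (induction S Z arbitrary: B rule: toggle.induct)
  case (2 S C)
  then show ?case by auto
next
  case (3 S C D V)
  show ?case
  proof (cases "C \<inter> S \<noteq> {} \<or> D \<subseteq> S")
    case True
    then consider "C \<inter> S \<noteq> {}" | "C \<inter> S = {}" "D \<subseteq> S" by blast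
    then show ?thesis
    proof cases
      case 1
      with 3 show ?thesis by (auto simp: set_compositions_iff)
    next
      case 2
      then have "D \<noteq> {}" "(C \<union> D) - S = C" "(C \<union> D) \<inter> S = D"
        using 3(2) by (auto simp: set_compositions_iff)
      with 2 show ?thesis by (cases V) auto
    qed
  next
    case False
    have DV: "D # V \<in> set_compositions (\<Union>(set (D # V)))"
      using 3 by (auto simp: set_compositions_iff)
    with 3 False have IH: "toggle S (toggle S (D # V)) = D # V"
      by auto
    from False obtain x where "x \<in> D" "x \<notin> S" by auto
    then have "x \<in> hd (toggle S (D # V))"
      using toggle_hd[of x "D # V" S] by auto
    moreover obtain E W where EW: "toggle S (D # V) = E # W"
      by (cases "toggle S (D # V)") (use IH in auto)
    ultimately have "\<not> E \<subseteq> S"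
      using \<open>x \<notin> S\<close> by auto
    with EW IH False show ?thesis
      by auto
  qed
qed auto

lemma length_toggle:
  assumes "\<not> hd Z \<subseteq> S" "S \<inter> \<Union>(set Z) \<noteq> {}" "{} \<notin> set Z"
  shows "length (toggle S Z) = Suc (length Z) \<or> length Z = Suc (length (toggle S Z))"
  using assms by (induction S Z rule: toggle.induct) (auto split: if_splits)

lemma toggle_not_Nil: "Z \<noteq> [] \<Longrightarrow> toggle S Z \<noteq> []"
  by (cases "(S, Z)" rule: toggle.cases) auto

lemma block_sign_toggle:
  assumes "\<not> hd Z \<subseteq> S" "S \<inter> \<Union>(set Z) \<noteq> {}" "{} \<notin> set Z"
  shows "block_sign (toggle S Z) = (- block_sign Z :: 'f::field)"
proof -
  have "Z \<noteq> []" using assms by auto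
  then have "length Z > 0" "length (toggle S Z) > 0"
    using toggle_not_Nil[of Z S] by auto
  then obtain m m' where "length Z = Suc m" "length (toggle S Z) = Suc m'"
    by (metis Suc_pred)
  with length_toggle[OF assms] show ?thesis
    by (auto simp: block_sign_def)
qed

text \<open>
  A component \<open>Y\<close> sees only one of the two pieces that a toggle merges or separates: the piece
  inside \<open>S\<close> if \<open>Y \<subseteq> S\<close>, and the piece outside \<open>S\<close> if \<open>Y \<inter> S = {}\<close>.
\<close>

lemma trace_on_toggle: "Y \<subseteq> S \<or> Y \<inter> S = {} \<Longrightarrow> trace_on Y (toggle S Z) = trace_on Y Z"
proof (induction S Z rule: toggle.induct)
  case (3 S C D V)
  have *: "Y \<inter> (C - S) = (if Y \<subseteq> S then {} else Y \<inter> C)" "Y \<inter> (C \<inter> S) = (if Y \<subseteq> S then Y \<inter> C else {})"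
    using 3(2) by auto
  have **: "Y \<inter> (C \<union> D) = (if Y \<subseteq> S then Y \<inter> D else Y \<inter> C)" if "C \<inter> S = {}" "D \<subseteq> S"
    using 3(2) that by auto
  have ***: "Y \<subseteq> S \<Longrightarrow> C \<inter> S = {} \<Longrightarrow> Y \<inter> C = {}" "\<not> Y \<subseteq> S \<Longrightarrow> D \<subseteq> S \<Longrightarrow> Y \<inter> D = {}"
    using 3(2) by auto
  show ?case
    using 3 by (simp add: * ** ***)
qed auto

text \<open>
  Splitting off \<open>C \<inter> S\<close> behind \<open>C - S\<close> moves the trace of \<open>S\<close> behind the traces of the other
  components of the right factor. It is there already if \<open>S\<close> is the last of them. Reversal gives
  the mirror image, in which \<open>C \<inter> S\<close> is split off in front and \<open>S\<close> is the first component.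
\<close>

lemma meet_comp_toggle:
  assumes "\<And>Y. Y \<in> set Q \<Longrightarrow> Y \<inter> S = {}"
  shows "meet_comp (toggle S Z) (Q @ [S]) = meet_comp Z (Q @ [S])" (is ?last)
    and "meet_comp (rev (toggle S Z)) (S # Q) = meet_comp (rev Z) (S # Q)" (is ?first)
proof -
  have split_S: "trace_on (C - S) Q = trace_on C Q" "trace_on (C \<inter> S) Q = []" for C
    using assms by (auto intro!: trace_on_cong trace_on_disjoint)
  have inside_S: "trace_on (C \<union> D) Q = trace_on C Q" "trace_on D Q = []" if "D \<subseteq> S" for C D
  proof -
    have "Y \<inter> D = {}" if "Y \<in> set Q" for Y
      using assms[OF that] \<open>D \<subseteq> S\<close> by auto
    then show "trace_on (C \<union> D) Q = trace_on C Q" "trace_on D Q = []"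
      by (auto intro!: trace_on_cong trace_on_disjoint)
  qed
  have on_S: "(C - S) \<inter> S = {}" "C \<inter> S \<inter> S = C \<inter> S" for C by auto
  have union_S: "(C \<union> D) \<inter> S = D \<inter> S" if "C \<inter> S = {}" for C D using that by auto
  show ?last
    by (induction Z rule: induct_list012) (auto simp: split_S inside_S on_S union_S)
  show ?first
    by (induction Z rule: induct_list012) (auto simp: split_S inside_S on_S union_S)
qed

section \<open>The action of a set composition on \<open>e_comp Q\<close>\<close>

lemma trace_on_glue_cong:
  "(\<And>B. B \<in> set Q \<Longrightarrow> trace_on X (\<phi> B) = trace_on X (\<phi>' B)) \<Longrightarrow>
    trace_on X (glue Q \<phi>) = trace_on X (glue Q \<phi>')"
  by (induction Q) (auto simp: glue_def)

lemma finite_choices: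
  assumes "Q \<in> set_compositions A" "finite A"
  shows "finite (choices Q)"
proof (intro finite_PiE finite_anchored)
  fix B assume "B \<in> set Q"
  then have "B \<subseteq> A" using assms(1) by (auto simp: set_compositions_iff)
  then show "finite B" using assms(2) finite_subset by blast
qed simp

lemma block_facts:
  assumes "Q \<in> set_compositions A" "finite A" "B \<in> set Q"
  shows "B \<noteq> {}" "B \<subseteq> A" "finite B" "Min B \<in> B"
proof -
  show *: "B \<noteq> {}" "B \<subseteq> A" using assms by (auto simp: set_compositions_iff)
  then show "finite B" using assms(2) finite_subset by blast
  with * show "Min B \<in> B" by simp
qed

text \<open>
  Some component \<open>B\<close> of \<open>Q\<close> meets two components of \<open>P\<close>, and one of these, \<open>S\<close>, does not contain
  the minimum of \<open>B\<close>. Toggling by \<open>S\<close> the term chosen from \<open>e_set B\<close> changes the sign and does not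
  change the product with \<open>P\<close>, so all terms cancel.
\<close>

lemma basis_wedge_e_comp_not_refines:
  assumes P: "P \<in> set_compositions A" and Q: "Q \<in> set_compositions A" and "finite A"
    and "\<not> Q \<preceq> P"
  shows "basis P \<curlywedge> e_comp Q = (0 :: 'f::field comb)"
proof -
  obtain B where B: "B \<in> set Q" and nref: "\<And>Y. Y \<in> set P \<Longrightarrow> \<not> B \<subseteq> Y"
    using \<open>\<not> Q \<preceq> P\<close> by (auto simp: refines_def)
  note Bf = block_facts[OF Q \<open>finite A\<close> B]
  have UP: "\<Union>(set P) = A" using P by (simp add: set_compositions_iff)
  with Bf obtain X where X: "X \<in> set P" "Min B \<in> X" by blast
  from nref[OF X(1)] UP Bf obtain x S where S: "x \<in> B" "x \<notin> X" "x \<in> S" "S \<in> set P" by blast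
  then have "S \<inter> X = {}" using disjoint_blocks[OF P S(4) X(1)] by auto
  with X have minS: "Min B \<notin> S" by auto
  have PS: "Y \<subseteq> S \<or> Y \<inter> S = {}" if "Y \<in> set P" for Y
    using disjoint_blocks[OF P that S(4)] by auto
  define \<tau> where "\<tau> \<phi> = \<phi>(B := toggle S (\<phi> B))" for \<phi> :: "nat set \<Rightarrow> nat set list"
  \<comment> \<open>The coefficient of the term \<open>\<phi>\<close> changes sign under \<open>\<tau>\<close>, which toggles only the choice for \<open>B\<close>.\<close>
  define f where "f \<phi> = (scale (\<Prod>B \<in> set Q. block_sign (\<phi> B)) (basis (meet_comp P (glue Q \<phi>))) :: 'f comb)"
      for \<phi>
  have anch: "Z \<in> set_compositions B" "Min B \<in> hd Z" "\<not> hd Z \<subseteq> S" "toggle S Z \<in> anchored B"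
    "S \<inter> \<Union>(set Z) \<noteq> {}" "{} \<notin> set Z"
    if Z: "Z \<in> anchored B" for Z
  proof -
    show *: "Z \<in> set_compositions B" "Min B \<in> hd Z" using Z by (auto simp: anchored_def)
    then show "\<not> hd Z \<subseteq> S" using minS by auto
    then show "toggle S Z \<in> anchored B"
      using toggle_in_set_compositions[OF *(1)] toggle_hd[OF *(2) minS] by (simp add: anchored_def)
    show "S \<inter> \<Union>(set Z) \<noteq> {}" "{} \<notin> set Z" using * S by (auto simp: set_compositions_iff)
  qed
  have \<phi>B: "\<phi> B \<in> anchored B" if "\<phi> \<in> choices Q" for \<phi>
    using that B by (rule PiE_mem)
  have "(\<Sum>\<phi> \<in> choices Q. f \<phi>) = 0"
  proof (rule sum_involution_eq_0[where h = \<tau>])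
    fix \<phi> assume \<phi>: "\<phi> \<in> choices Q"
    note a = anch[OF \<phi>B[OF \<phi>]]
    show "\<tau> \<phi> \<in> choices Q"
    proof -
      have "\<tau> \<phi> \<in> (\<Pi>\<^sub>E C \<in> insert B (set Q). anchored C)"
        unfolding \<tau>_def using a(4) \<phi> B by (auto simp: PiE_iff extensional_def)
      with B show ?thesis by (simp add: insert_absorb)
    qed
    show "\<tau> (\<tau> \<phi>) = \<phi>"
      using toggle_toggle[OF a(1,3)] by (simp add: \<tau>_def)
    have sg: "block_sign (toggle S (\<phi> B)) = (- block_sign (\<phi> B) :: 'f)"
      using a by (intro block_sign_toggle) auto
    show "\<tau> \<phi> \<noteq> \<phi>"
    proof
      assume "\<tau> \<phi> = \<phi>"
      then have "toggle S (\<phi> B) = \<phi> B" by (metis \<tau>_def fun_upd_same)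
      moreover have "length (toggle S (\<phi> B)) \<noteq> length (\<phi> B)"
        using length_toggle[OF a(3,5,6)] by auto
      ultimately show False by simp
    qed
    have "(\<Prod>C \<in> set Q. block_sign (\<tau> \<phi> C)) =
        block_sign (\<tau> \<phi> B) * (\<Prod>C \<in> set Q - {B}. block_sign (\<tau> \<phi> C) :: 'f)"
      using B by (intro prod.remove) auto
    also have "(\<Prod>C \<in> set Q - {B}. block_sign (\<tau> \<phi> C) :: 'f) = (\<Prod>C \<in> set Q - {B}. block_sign (\<phi> C))"
      by (intro prod.cong) (auto simp: \<tau>_def)
    also have "block_sign (\<tau> \<phi> B) * \<dots> = - (block_sign (\<phi> B) * \<dots>)"
      using sg by (simp add: \<tau>_def)
    also have "block_sign (\<phi> B) * (\<Prod>C \<in> set Q - {B}. block_sign (\<phi> C)) =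
        (\<Prod>C \<in> set Q. block_sign (\<phi> C) :: 'f)"
      using B by (intro prod.remove[symmetric]) auto
    finally have sgn: "(\<Prod>C \<in> set Q. block_sign (\<tau> \<phi> C)) = - (\<Prod>C \<in> set Q. block_sign (\<phi> C) :: 'f)" .
    have "meet_comp P (glue Q (\<tau> \<phi>)) = meet_comp P (glue Q \<phi>)"
    proof (rule meet_comp_cong, rule trace_on_glue_cong)
      fix Y C assume "Y \<in> set P" "C \<in> set Q"
      show "trace_on Y (\<tau> \<phi> C) = trace_on Y (\<phi> C)"
        using trace_on_toggle[OF PS[OF \<open>Y \<in> set P\<close>]] by (simp add: \<tau>_def)
    qed
    with sgn show "f (\<tau> \<phi>) + f \<phi> = 0"
      by (simp add: f_def comb.scale_minus_left)
  qed
  then show ?thesis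
    by (simp add: e_comp_expansion[OF Q \<open>finite A\<close>] f_def wedge_linear)
qed

text \<open>
  Every component of \<open>Q\<close> lies inside one component of \<open>P\<close>. The terms chosen for the components of
  \<open>Q\<close> are then moved as a whole, in the way in which \<open>P\<close> moves the components themselves.
\<close>

lemma basis_wedge_e_comp_refines:
  assumes P: "P \<in> set_compositions A" and Q: "Q \<in> set_compositions A" and "finite A"
    and ref: "Q \<preceq> P"
  shows "basis P \<curlywedge> e_comp Q = (e_comp (meet_comp P Q) :: 'f::field comb)"
proof -
  have set_eq: "set (meet_comp P Q) = set Q"
    using refines_iff_meet_comp[OF P Q] ref by simp
  have PQ: "meet_comp P Q \<in> set_compositions A"
    using meet_comp_in_set_compositions[OF P Q] by simp
  have "meet_comp P (glue Q \<phi>) = glue (meet_comp P Q) \<phi>" if \<phi>: "\<phi> \<in> choices Q" for \<phi>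
  proof -
    have blocks: "{} \<notin> set (\<phi> B)" "\<Union>(set (\<phi> B)) = B" if "B \<in> set Q" for B
      using PiE_mem[OF \<phi> that] by (auto simp: anchored_def set_compositions_iff)
    have "trace_on X (glue Q \<phi>) = glue (trace_on X Q) \<phi>" if X: "X \<in> set P" for X
    proof -
      have inside: "trace_on X R = R" if "{} \<notin> set R" "\<Union>(set R) \<subseteq> X" for R
        using that by (induction R) (auto simp: Int_absorb1)
      have outside: "trace_on X R = []" if "\<Union>(set R) \<inter> X = {}" for R
        using that by (intro trace_on_disjoint) auto
      have "trace_on X (glue R \<phi>) = glue (trace_on X R) \<phi>" if "set R \<subseteq> set Q" for R
        using that
      proof (induction R)
        case (Cons B R)
        then have B: "B \<in> set Q" by simp
        have "B \<noteq> {}" using block_facts(1)[OF Q \<open>finite A\<close> B] .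
        have "B \<subseteq> X \<or> B \<inter> X = {}" by (rule refines_dichotomy[OF P ref X B])
        then have "trace_on X (\<phi> B) = (if X \<inter> B = {} then [] else \<phi> B) \<and> (X \<inter> B \<noteq> {} \<longrightarrow> X \<inter> B = B)"
          using inside[of "\<phi> B"] outside[of "\<phi> B"] blocks[OF B] \<open>B \<noteq> {}\<close> by auto
        with Cons show ?case by (auto simp: glue_def)
      qed (simp add: glue_def)
      then show ?thesis by simp
    qed
    then have "meet_comp R (glue Q \<phi>) = glue (meet_comp R Q) \<phi>" if "set R \<subseteq> set P" for R
      using that by (induction R) (auto simp: glue_def)
    then show ?thesis by simp
  qed
  then show ?thesis
    by (simp add: e_comp_expansion[OF Q \<open>finite A\<close>] e_comp_expansion[OF PQ \<open>finite A\<close>]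
        wedge_linear set_eq)
qed

section \<open>Factorisation along components\<close>

lemma subspace_comp_algebra: "comb.subspace (comp_algebra A :: 'f::field comb set)"
proof (rule comb.subspaceI)
  fix x y :: "'f comb" assume "x \<in> comp_algebra A" "y \<in> comp_algebra A"
  then show "x + y \<in> comp_algebra A"
    using keys_add[of x y] unfolding comp_algebra_def by blast
next
  fix c and x :: "'f comb" assume "x \<in> comp_algebra A"
  then show "scale c x \<in> comp_algebra A"
    using keys_scale[of c x] unfolding comp_algebra_def by blast
qed (simp add: comp_algebra_def)

lemma basis_in_comp_algebra [simp]:
  "basis P \<in> (comp_algebra A :: 'f::field comb set) \<longleftrightarrow> P \<in> set_compositions A"
  by (simp add: comp_algebra_def)

lemma comp_algebra_induct [consumes 1, case_names zero add scale basis]: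
  fixes p :: "'f::field comb"
  assumes "p \<in> comp_algebra A"
    and "Pr 0" and "\<And>p q. Pr p \<Longrightarrow> Pr q \<Longrightarrow> Pr (p + q)" and "\<And>c p. Pr p \<Longrightarrow> Pr (scale c p)"
    and "\<And>P. P \<in> set_compositions A \<Longrightarrow> Pr (basis P)"
  shows "Pr p"
  by (rule comb_induct_on[of p "set_compositions A"])
     (use assms(1) in \<open>simp add: comp_algebra_def\<close>, (rule assms(2-) | assumption)+)

lemmas comp_algebra_closed =
  comb.subspace_0[OF subspace_comp_algebra] comb.subspace_add[OF subspace_comp_algebra]
  comb.subspace_scale[OF subspace_comp_algebra] comb.subspace_diff[OF subspace_comp_algebra]
  comb.subspace_sum[OF subspace_comp_algebra]

lemma wedge_in_comp_algebra:
  assumes "p \<in> comp_algebra A" "q \<in> comp_algebra A"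
  shows "p \<curlywedge> q \<in> (comp_algebra A :: 'f::field comb set)"
  using assms(1)
proof (induction rule: comp_algebra_induct)
  case (basis P)
  from assms(2) show ?case
  proof (induction rule: comp_algebra_induct)
    case (basis Q)
    show ?case
      using meet_comp_in_set_compositions[OF \<open>P \<in> set_compositions A\<close> basis] by simp
  qed (simp_all add: comp_algebra_closed wedge_right.add wedge_linear)
qed (simp_all add: comp_algebra_closed wedge_left.add wedge_linear)

lemma append_in_set_compositions:
  "P \<in> set_compositions B \<Longrightarrow> Q \<in> set_compositions C \<Longrightarrow> B \<inter> C = {} \<Longrightarrow>
    P @ Q \<in> set_compositions (B \<union> C)"
  by (fastforce simp: set_compositions_iff sorted_wrt_append)

lemma vee_in_comp_algebra:
  assumes "p \<in> comp_algebra B" "q \<in> comp_algebra C" "B \<inter> C = {}"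
  shows "p \<curlyvee> q \<in> (comp_algebra (B \<union> C) :: 'f::field comb set)"
  using assms(1)
proof (induction rule: comp_algebra_induct)
  case (basis P)
  from assms(2) show ?case
  proof (induction rule: comp_algebra_induct)
    case (basis Q)
    show ?case
      using append_in_set_compositions[OF \<open>P \<in> set_compositions B\<close> basis assms(3)]
      by (simp add: basis_vee_basis comp_algebra_closed)
  qed (simp_all add: comp_algebra_closed vee_right.add vee_linear)
qed (simp_all add: comp_algebra_closed vee_left.add vee_linear)

lemma e_set_in_comp_algebra: "e_set B \<in> comp_algebra B"
  unfolding e_set_eq
  by (intro comp_algebra_closed) (simp add: anchored_def)

lemma set_compositions_Cons_iff: "B # Q \<in> set_compositions A \<longleftrightarrow>
    B \<noteq> {} \<and> Q \<in> set_compositions (\<Union>(set Q)) \<and> B \<inter> \<Union>(set Q) = {} \<and> A = B \<union> \<Union>(set Q)"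
  by (auto simp: set_compositions_iff)

lemma e_comp_in_comp_algebra: "Q \<in> set_compositions A \<Longrightarrow> e_comp Q \<in> comp_algebra A"
proof (induction Q arbitrary: A)
  case Nil
  then show ?case by simp
next
  case (Cons B Q)
  then show ?case
    unfolding set_compositions_Cons_iff e_comp_Cons
    by (auto intro!: vee_in_comp_algebra e_set_in_comp_algebra)
qed

lemma basis_wedge_e_comp:
  assumes "P \<in> set_compositions A" "Q \<in> set_compositions A" "finite A"
  shows "basis P \<curlywedge> e_comp Q = (if Q \<preceq> P then e_comp (meet_comp P Q) else 0 :: 'f::field comb)"
  by (simp add: basis_wedge_e_comp_not_refines[OF assms] basis_wedge_e_comp_refines[OF assms])

abbreviation blocks_in :: "nat set \<Rightarrow> nat set list \<Rightarrow> nat set list" where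
  "blocks_in B Q \<equiv> filter (\<lambda>Y. Y \<subseteq> B) Q"

lemma trace_on_blocks_in:
  assumes "\<And>Y. Y \<in> set Q \<Longrightarrow> Y \<subseteq> B \<or> Y \<inter> B = {}" "X \<subseteq> B"
  shows "trace_on X (blocks_in B Q) = trace_on X Q"
  using assms
proof (induction Q)
  case (Cons Y Q)
  then show ?case using Cons(2)[of Y] by auto
qed simp

lemma meet_comp_blocks_in:
  assumes "\<And>Y. Y \<in> set Q \<Longrightarrow> Y \<subseteq> B \<or> Y \<inter> B = {}" "P \<in> set_compositions B"
  shows "meet_comp P (blocks_in B Q) = meet_comp P Q"
  using assms by (intro meet_comp_cong trace_on_blocks_in) (auto simp: set_compositions_iff)

lemma blocks_in_set_compositions:
  assumes "Q \<in> set_compositions A" "B \<subseteq> A" "\<And>Y. Y \<in> set Q \<Longrightarrow> Y \<subseteq> B \<or> Y \<inter> B = {}"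
  shows "blocks_in B Q \<in> set_compositions B"
proof -
  have "B \<subseteq> \<Union>(set (blocks_in B Q))"
  proof
    fix x assume "x \<in> B"
    with assms(1,2) obtain Y where "Y \<in> set Q" "x \<in> Y"
      by (auto simp: set_compositions_iff)
    with assms(3)[of Y] \<open>x \<in> B\<close> show "x \<in> \<Union>(set (blocks_in B Q))" by auto
  qed
  with assms(1) show ?thesis
    by (auto simp: set_compositions_iff sorted_wrt_filter)
qed

text \<open>
  This is where the elements \<open>e_comp Q\<close> are better than arbitrary ones: the product of \<open>P @ P'\<close>
  with a general element involves the traces of each term on both parts at once, whereas the image
  of \<open>e_comp Q\<close> is again some \<open>e_comp Q'\<close>, which factors.
\<close>

lemma vee_wedge_e_comp:
  assumes p: "p \<in> comp_algebra B" and q: "q \<in> comp_algebra C" and "B \<inter> C = {}"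
    and Q: "Q \<in> set_compositions (B \<union> C)" and fin: "finite (B \<union> C)"
    and QBC: "\<And>Y. Y \<in> set Q \<Longrightarrow> Y \<subseteq> B \<or> Y \<subseteq> C"
  shows "(p \<curlyvee> q) \<curlywedge> e_comp Q =
      (p \<curlywedge> e_comp (blocks_in B Q)) \<curlyvee> (q \<curlywedge> e_comp (blocks_in C Q) :: 'f::field comb)"
proof -
  have Bdich: "Y \<subseteq> B \<or> Y \<inter> B = {}" and Cdich: "Y \<subseteq> C \<or> Y \<inter> C = {}" if "Y \<in> set Q" for Y
    using QBC[OF that] \<open>B \<inter> C = {}\<close> by auto
  have QB: "blocks_in B Q \<in> set_compositions B"
    using Q Bdich by (intro blocks_in_set_compositions) auto
  have QC: "blocks_in C Q \<in> set_compositions C"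
    using Q Cdich by (intro blocks_in_set_compositions) auto
  have finB: "finite B" "finite C" using fin by auto
  from p show ?thesis
  proof (induction rule: comp_algebra_induct)
    case (basis P)
    note P = basis
    from q show ?case
    proof (induction rule: comp_algebra_induct)
      case (basis P')
      note P' = basis
      have PP: "P @ P' \<in> set_compositions (B \<union> C)"
        by (rule append_in_set_compositions[OF P P' \<open>B \<inter> C = {}\<close>])
      have UP: "\<Union>(set P) = B" "\<Union>(set P') = C"
        using P P' by (auto simp: set_compositions_iff)
      have ref: "Q \<preceq> P @ P' \<longleftrightarrow> blocks_in B Q \<preceq> P \<and> blocks_in C Q \<preceq> P'"
      proof
        assume l: "Q \<preceq> P @ P'"
        have ne: "Y \<noteq> {}" if "Y \<in> set Q" for Y
          using Q that by (auto simp: set_compositions_iff)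
        have "\<exists>X \<in> set P. Y \<subseteq> X" if "Y \<in> set Q" "Y \<subseteq> B" for Y
        proof -
          from l that obtain X where "X \<in> set P \<or> X \<in> set P'" "Y \<subseteq> X"
            unfolding refines_def by fastforce
          moreover have "X \<notin> set P'"
            using that ne[OF that(1)] \<open>Y \<subseteq> X\<close> UP \<open>B \<inter> C = {}\<close> by blast
          ultimately show ?thesis by blast
        qed
        moreover have "\<exists>X \<in> set P'. Y \<subseteq> X" if "Y \<in> set Q" "Y \<subseteq> C" for Y
        proof -
          from l that obtain X where "X \<in> set P \<or> X \<in> set P'" "Y \<subseteq> X"
            unfolding refines_def by fastforce
          moreover have "X \<notin> set P"
            using that ne[OF that(1)] \<open>Y \<subseteq> X\<close> UP \<open>B \<inter> C = {}\<close> by blast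
          ultimately show ?thesis by blast
        qed
        ultimately show "blocks_in B Q \<preceq> P \<and> blocks_in C Q \<preceq> P'"
          by (simp add: refines_def)
      next
        assume "blocks_in B Q \<preceq> P \<and> blocks_in C Q \<preceq> P'"
        then show "Q \<preceq> P @ P'"
          unfolding refines_def using QBC by (simp add: bex_Un ball_conj_distrib) blast
      qed
      have disj: "\<Union>(set P) \<inter> \<Union>(set P') = {}"
        using UP \<open>B \<inter> C = {}\<close> by simp
      show ?case
        using ref disj
        by (simp add: basis_vee_basis basis_wedge_e_comp[OF PP Q fin] basis_wedge_e_comp[OF P QB finB(1)]
            basis_wedge_e_comp[OF P' QC finB(2)] e_comp_append
            meet_comp_blocks_in[OF Bdich P] meet_comp_blocks_in[OF Cdich P'])
    qed (simp_all add: vee_right.add wedge_left.add wedge_right.add vee_linear wedge_linear)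
  qed (simp_all add: vee_left.add wedge_left.add vee_linear wedge_linear)
qed

definition vees :: "'f::field comb list \<Rightarrow> 'f comb" where
  "vees ps = foldr (\<curlyvee>) ps (basis [])"

lemma vees_simps [simp]:
  "vees [] = basis []" "vees (p # ps) = p \<curlyvee> vees ps"
  by (simp_all add: vees_def)

lemma vees_append: "vees (ps @ qs) = vees ps \<curlyvee> (vees qs :: 'f::field comb)"
  by (induction ps) (auto simp: vee_assoc)

lemma e_comp_vees: "e_comp Q = vees (map e_set Q)"
  by (induction Q) (auto simp: e_comp_Cons)

lemma vees_zero: "0 \<in> set ps \<Longrightarrow> vees ps = (0 :: 'f::field comb)"
  by (induction ps) auto

lemma e_comp_wedge_e_comp:
  assumes "R \<in> set_compositions A" "Q \<in> set_compositions A" "finite A" "Q \<preceq> R"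
  shows "e_comp R \<curlywedge> e_comp Q = (vees (map (\<lambda>B. e_set B \<curlywedge> e_comp (blocks_in B Q)) R) :: 'f::field comb)"
  using assms
proof (induction R arbitrary: A Q)
  case Nil
  then have "A = {}" by (simp add: set_compositions_iff)
  with Nil have "Q = []" by (cases Q) (auto simp: set_compositions_iff)
  then show ?case by simp
next
  case (Cons B R)
  define C where "C = \<Union>(set R)"
  have B: "B \<noteq> {}" "B \<inter> C = {}" "A = B \<union> C" and R: "R \<in> set_compositions C"
    using Cons.prems(1) unfolding set_compositions_Cons_iff C_def by auto
  have QBC: "Y \<subseteq> B \<or> Y \<subseteq> C" if "Y \<in> set Q" for Y
    using Cons.prems(4) that unfolding refines_def C_def by auto
  then have Cdich: "Y \<subseteq> C \<or> Y \<inter> C = {}" if "Y \<in> set Q" for Y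
    using that B by blast
  have QC: "blocks_in C Q \<in> set_compositions C"
    using Cons.prems(2) Cdich B by (intro blocks_in_set_compositions) auto
  have "blocks_in C Q \<preceq> R"
  proof -
    have "\<exists>X \<in> set R. Y \<subseteq> X" if "Y \<in> set Q" "Y \<subseteq> C" for Y
    proof -
      have "Y \<noteq> {}" using Cons.prems(2) that by (auto simp: set_compositions_iff)
      with that B(2) have "\<not> Y \<subseteq> B" by auto
      with that Cons.prems(4) show ?thesis by (auto simp: refines_def)
    qed
    then show ?thesis by (simp add: refines_def)
  qed
  then have IH: "e_comp R \<curlywedge> e_comp (blocks_in C Q) =
      (vees (map (\<lambda>B. e_set B \<curlywedge> e_comp (blocks_in B (blocks_in C Q))) R) :: 'f comb)"
    using Cons.prems(3) B by (intro Cons.IH[OF R QC]) auto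
  have "blocks_in D (blocks_in C Q) = blocks_in D Q" if "D \<in> set R" for D
    using that by (auto simp: C_def intro!: filter_cong)
  then have eq: "map (\<lambda>B. e_set B \<curlywedge> e_comp (blocks_in B (blocks_in C Q)) :: 'f comb) R =
      map (\<lambda>B. e_set B \<curlywedge> e_comp (blocks_in B Q)) R"
    by simp
  have "e_comp (B # R) \<curlywedge> e_comp Q =
      (e_set B \<curlywedge> e_comp (blocks_in B Q)) \<curlyvee> (e_comp R \<curlywedge> e_comp (blocks_in C Q) :: 'f comb)"
    unfolding e_comp_Cons
    using Cons.prems B QBC
    by (intro vee_wedge_e_comp e_set_in_comp_algebra e_comp_in_comp_algebra R) auto
  then show ?case
    unfolding IH eq by simp
qed

section \<open>Lie projections\<close>

lemma singleton_in_set_compositions [simp]: "[B] \<in> set_compositions B \<longleftrightarrow> B \<noteq> {}"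
  by (auto simp: set_compositions_iff)

lemma e_set_wedge_e_comp:
  assumes "Q \<in> set_compositions B" "finite B"
  shows "e_set B \<curlywedge> e_comp Q =
    (\<Sum>P | P \<in> anchored B \<and> Q \<preceq> P. scale (block_sign P) (e_comp (meet_comp P Q)) :: 'f::field comb)"
proof -
  have "e_set B \<curlywedge> e_comp Q =
      (\<Sum>P \<in> anchored B. scale (block_sign P) (if Q \<preceq> P then e_comp (meet_comp P Q) else 0) :: 'f comb)"
    unfolding e_set_eq wedge_linear
  proof (intro sum.cong refl)
    fix P assume "P \<in> anchored B"
    then have "P \<in> set_compositions B" by (simp add: anchored_def)
    then show "scale (block_sign P) (basis P \<curlywedge> e_comp Q) =
        (scale (block_sign P) (if Q \<preceq> P then e_comp (meet_comp P Q) else 0) :: 'f comb)"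
      by (simp only: basis_wedge_e_comp[OF _ assms])
  qed
  also have "\<dots> = (\<Sum>P | P \<in> anchored B \<and> Q \<preceq> P. scale (block_sign P) (e_comp (meet_comp P Q)))"
    using finite_anchored[OF assms(2)] by (intro sum.mono_neutral_cong_right) auto
  finally show ?thesis .
qed

lemma toggle_anchored:
  assumes "Z \<in> anchored B" "Min B \<notin> S"
  shows "toggle S Z \<in> anchored B" "\<not> hd Z \<subseteq> S"
proof -
  have Z: "Z \<in> set_compositions B" "Min B \<in> hd Z"
    using assms by (auto simp: anchored_def)
  with assms(2) show "\<not> hd Z \<subseteq> S" by auto
  with Z toggle_in_set_compositions[OF Z(1)] toggle_hd[OF Z(2) assms(2)]
  show "toggle S Z \<in> anchored B" by (simp add: anchored_def)
qed

text \<open>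
  The Lie projection \<open>e_set B\<close> kills a product of letters unless the last letter contains the
  minimum of \<open>B\<close>: toggling by the last letter \<open>S\<close> does not change \<open>meet_comp P (Q @ [S])\<close>.
\<close>

lemma e_set_wedge_e_comp_eq_0:
  assumes QS: "Q @ [S] \<in> set_compositions B" and fin: "finite B" and min: "Min B \<notin> S"
  shows "e_set B \<curlywedge> e_comp (Q @ [S]) = (0 :: 'f::field comb)"
  unfolding e_set_wedge_e_comp[OF QS fin]
proof (rule sum_involution_eq_0[where h = "toggle S"])
  have S: "S \<noteq> {}" "S \<subseteq> B" and disj: "\<And>Y. Y \<in> set Q \<Longrightarrow> Y \<inter> S = {}"
    using QS by (auto simp: set_compositions_iff sorted_wrt_append)
  fix P assume "P \<in> {P \<in> anchored B. Q @ [S] \<preceq> P}"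
  then have P: "P \<in> anchored B" "Q @ [S] \<preceq> P" and PB: "P \<in> set_compositions B"
    by (auto simp: anchored_def)
  note tog = toggle_anchored[OF P(1) min]
  have tB: "toggle S P \<in> set_compositions B" using tog by (simp add: anchored_def)
  have meet: "meet_comp (toggle S P) (Q @ [S]) = meet_comp P (Q @ [S])"
    by (rule meet_comp_toggle(1)[OF disj])
  have ne: "S \<inter> \<Union>(set P) \<noteq> {}" "{} \<notin> set P"
    using PB S by (auto simp: set_compositions_iff)
  show "toggle S P \<in> {P \<in> anchored B. Q @ [S] \<preceq> P}"
    using P(2) tog meet unfolding mem_Collect_eq
    by (simp only: refines_iff_meet_comp[OF PB QS] refines_iff_meet_comp[OF tB QS])
  show "toggle S (toggle S P) = P"
    by (rule toggle_toggle[OF PB tog(2)])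
  show "toggle S P \<noteq> P"
    using length_toggle[OF tog(2) ne] by (metis n_not_Suc_n)
  show "scale (block_sign (toggle S P)) (e_comp (meet_comp (toggle S P) (Q @ [S]))) +
      scale (block_sign P) (e_comp (meet_comp P (Q @ [S]))) = (0 :: 'f comb)"
    unfolding meet block_sign_toggle[OF tog(2) ne] by (simp add: comb.scale_minus_left)
qed

lemma last_toggle:
  assumes "S \<inter> last Z = {}" "S \<inter> \<Union>(set Z) \<noteq> {}" "{} \<notin> set Z"
  shows "last (toggle S Z) = last Z"
  using assms
proof (induction Z rule: induct_list012)
  case (3 C D V)
  show ?case
  proof (cases "C \<inter> S \<noteq> {} \<or> D \<subseteq> S")
    case True
    with 3 show ?thesis by (cases V) auto
  next
    case False
    with 3 have "last (toggle S (D # V)) = last (D # V)"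
      by (intro 3) auto
    moreover have "toggle S (D # V) \<noteq> []" by (rule toggle_not_Nil) simp
    ultimately show ?thesis using False by simp
  qed
qed auto

lemma block_sign_rev: "block_sign (rev Z) = block_sign Z"
  by (simp add: block_sign_def)

lemma rev_in_set_compositions [simp]: "rev P \<in> set_compositions A \<longleftrightarrow> P \<in> set_compositions A"
  by (simp add: set_compositions_iff sorted_wrt_rev Int_commute)

text \<open>
  Iterating this writes the image of a product of letters as an iterated commutator. Among the
  terms \<open>P\<close> of \<open>e_set B\<close> that \<open>q # Q\<close> refines, those with \<open>q\<close> inside the first component give
  \<open>e_set q \<curlyvee> x\<close>, and those with \<open>q\<close> as the last component give \<open>x \<curlyvee> e_set q\<close> with the opposite
  sign. The mirror image of the toggle by \<open>q\<close> cancels all others.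
\<close>

lemma e_set_wedge_e_comp_bracket:
  assumes qQ: "q # Q \<in> set_compositions B" and fin: "finite B" and min: "Min B \<notin> q"
  defines "x \<equiv> e_set (B - q) \<curlywedge> e_comp Q"
  shows "e_set B \<curlywedge> e_comp (q # Q) = (e_set q \<curlyvee> x) - (x \<curlyvee> e_set q :: 'f::field comb)"
proof -
  have q: "q \<noteq> {}" "q \<subseteq> B" and disj: "\<And>Y. Y \<in> set Q \<Longrightarrow> Y \<inter> q = {}"
    and Q: "Q \<in> set_compositions (B - q)" and neQ: "{} \<notin> set Q"
    using qQ by (auto simp: set_compositions_iff)
  have "B \<noteq> {}" using q by auto
  have Bq: "Min B \<in> B - q" using Min_in[OF fin \<open>B \<noteq> {}\<close>] min by simp
  have minq: "Min (B - q) = Min B"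
    using Bq fin by (intro Min_eqI) auto
  define f :: "nat set list \<Rightarrow> 'f comb" where
    "f P = scale (block_sign P) (e_comp (meet_comp P (q # Q)))" for P
  \<comment> \<open>The terms of \<open>e_set B\<close> that contribute, and those of \<open>e_set (B - q)\<close>, which index \<open>x\<close>.\<close>
  define V where "V = {P \<in> anchored B. q # Q \<preceq> P}"
  define V' where "V' = {P \<in> anchored (B - q). Q \<preceq> P}"
  define Va where "Va = {P \<in> V. q \<subseteq> hd P}"
  define Vb where "Vb = {P \<in> V. last P = q}"
  define Vc where "Vc = {P \<in> V. \<not> q \<subseteq> hd P \<and> last P \<noteq> q}"
  have finV: "finite V" using finite_anchored[OF fin] by (simp add: V_def)
  have V: "P \<in> set_compositions B" "P \<in> anchored B" "q # Q \<preceq> P" "P \<noteq> []" "Min B \<in> hd P"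
    "hd P \<in> set P" "last P \<in> set P" if "P \<in> V" for P
  proof -
    show *: "P \<in> set_compositions B" "P \<in> anchored B" "q # Q \<preceq> P" "Min B \<in> hd P"
      using that by (auto simp: V_def anchored_def)
    show "P \<noteq> []" using * \<open>B \<noteq> {}\<close> by (auto simp: set_compositions_iff)
    then show "hd P \<in> set P" "last P \<in> set P" by auto
  qed
  have "Va \<inter> Vb = {}"
  proof -
    have False if P: "P \<in> V" "q \<subseteq> hd P" "last P = q" for P
    proof -
      have "hd P \<noteq> last P" using V(5)[OF P(1)] P(3) min by auto
      then have "hd P \<inter> last P = {}"
        by (rule disjoint_blocks[OF V(1)[OF P(1)] V(6)[OF P(1)] V(7)[OF P(1)]])
      with P q show False by auto
    qed
    then show ?thesis by (auto simp: Va_def Vb_def)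
  qed
  then have split: "sum f V = sum f Va + sum f Vb + sum f Vc"
  proof -
    have "V = (Va \<union> Vb) \<union> Vc" "(Va \<union> Vb) \<inter> Vc = {}"
      by (auto simp: Va_def Vb_def Vc_def)
    moreover have "finite Va" "finite Vb" "finite Vc"
      using finV by (simp_all add: Va_def Vb_def Vc_def)
    ultimately show ?thesis
      using \<open>Va \<inter> Vb = {}\<close> by (simp add: sum.union_disjoint)
  qed
  have "sum f Vc = 0"
  proof (rule sum_involution_eq_0[where h = "\<lambda>P. rev (toggle q (rev P))"])
    fix P assume "P \<in> Vc"
    then have P: "P \<in> V" "\<not> q \<subseteq> hd P" "last P \<noteq> q" by (auto simp: Vc_def)
    note PV = V[OF P(1)]
    have hd: "hd P \<inter> q = {}"
      using refines_dichotomy[OF PV(1) PV(3) PV(6), of q] P(2) by auto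
    have last: "\<not> last P \<subseteq> q"
    proof
      assume "last P \<subseteq> q"
      moreover have "last P \<noteq> {}" using PV(1) PV(7) by (auto simp: set_compositions_iff)
      ultimately show False
        using refines_dichotomy[OF PV(1) PV(3) PV(7), of q] P(3) by auto
    qed
    let ?h = "rev (toggle q (rev P))"
    have R: "rev P \<in> set_compositions B" "\<not> hd (rev P) \<subseteq> q"
      using PV last by (simp_all add: hd_rev)
    have ne: "q \<inter> \<Union>(set (rev P)) \<noteq> {}" "{} \<notin> set (rev P)"
      using R(1) q by (auto simp: set_compositions_iff)
    have hB: "?h \<in> set_compositions B"
      using toggle_in_set_compositions[OF R] by simp
    have "last (toggle q (rev P)) = hd P"
      using last_toggle[OF _ ne] hd PV(4) by (simp add: last_rev Int_commute)
    moreover have tne: "toggle q (rev P) \<noteq> []" using PV(4) by (simp add: toggle_not_Nil)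
    ultimately have hdh: "hd ?h = hd P" by (simp add: hd_rev)
    obtain y where "y \<in> last P" "y \<notin> q" using last by auto
    then have "y \<in> last ?h"
      using toggle_hd[of y "rev P" q] PV(4) tne by (simp add: hd_rev last_rev)
    with \<open>y \<notin> q\<close> have lasth: "last ?h \<noteq> q" by auto
    have meet: "meet_comp ?h (q # Q) = meet_comp P (q # Q)"
      using meet_comp_toggle(2)[OF disj, of Q "rev P"] by simp
    have "q # Q \<preceq> ?h"
      using PV(3) meet
      by (simp only: refines_iff_meet_comp[OF PV(1) qQ] refines_iff_meet_comp[OF hB qQ])
    with hB hdh lasth P PV show "?h \<in> Vc"
      by (simp add: Vc_def V_def anchored_def)
    show "rev (toggle q (rev ?h)) = P"
      using toggle_toggle[OF R] by simp
    show "?h \<noteq> P"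
      using length_toggle[OF R(2) ne] by (metis length_rev n_not_Suc_n)
    show "f ?h + f P = 0"
      unfolding f_def meet block_sign_rev block_sign_toggle[OF R(2) ne]
      by (simp add: block_sign_rev comb.scale_minus_left)
  qed
  moreover have "sum f Va = e_set q \<curlyvee> x"
  proof -
    have "sum f Va = (\<Sum>P \<in> V'. scale (block_sign P) (e_set q \<curlyvee> e_comp (meet_comp P Q)))"
    proof (rule sum.reindex_bij_witness[where
          i = "\<lambda>P. (q \<union> hd P) # tl P" and j = "\<lambda>P. (hd P - q) # tl P"])
      fix P assume "P \<in> Va"
      then have P: "P \<in> V" "q \<subseteq> hd P" by (auto simp: Va_def)
      obtain C W where CW: "P = C # W" using V(4)[OF P(1)] by (cases P) auto
      have qC: "q \<subseteq> C" "Min B \<in> C" using P V(5)[OF P(1)] CW by auto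
      then show "(q \<union> hd ((hd P - q) # tl P)) # tl ((hd P - q) # tl P) = P"
        using CW by auto
      have CB: "C # W \<in> set_compositions B" using V(1)[OF P(1)] CW by simp
      have Wq: "Y \<inter> q = {}" if "Y \<in> set W" for Y
        using CB qC that by (auto simp: set_compositions_iff)
      have "C - q \<noteq> {}" "\<Union>(set W) \<inter> q = {}"
        using qC min Wq by auto
      then have "(C - q) # W \<in> set_compositions (B - q)"
        using CB unfolding set_compositions_Cons_iff by (elim conjE, intro conjI) auto
      moreover have "Q \<preceq> (C - q) # W"
        unfolding refines_def
      proof
        fix Y assume Y: "Y \<in> set Q"
        then obtain Z where "Z \<in> set P" "Y \<subseteq> Z"
          using refines_block[OF V(3)[OF P(1)], of Y] by auto
        with disj[OF Y] CW show "\<exists>Z \<in> set ((C - q) # W). Y \<subseteq> Z" by auto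
      qed
      ultimately show "(hd P - q) # tl P \<in> V'"
        using CW qC min minq by (simp add: V'_def anchored_def)
      have "trace_on C Q = trace_on (C - q) Q"
        using disj by (intro trace_on_cong) blast
      moreover have "meet_comp W (q # Q) = meet_comp W Q"
        using Wq by (intro meet_comp_cong) auto
      moreover have "C \<inter> q = q" using qC by auto
      ultimately have "meet_comp P (q # Q) = q # meet_comp ((hd P - q) # tl P) Q"
        using CW q by simp
      moreover have "block_sign ((hd P - q) # tl P) = (block_sign P :: 'f)"
        using CW by (simp add: block_sign_def)
      ultimately show "scale (block_sign ((hd P - q) # tl P))
          (e_set q \<curlyvee> e_comp (meet_comp ((hd P - q) # tl P) Q)) = f P"
        unfolding f_def by (simp only: e_comp_Cons)
    next
      fix P assume "P \<in> V'"
      then have P: "P \<in> set_compositions (B - q)" "Min B \<in> hd P" "Q \<preceq> P"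
        by (auto simp: V'_def anchored_def minq)
      obtain C W where CW: "P = C # W" using P(1) Bq by (cases P) (auto simp: set_compositions_iff)
      have Cq: "C \<inter> q = {}" "\<And>Y. Y \<in> set W \<Longrightarrow> Y \<inter> q = {}" using P(1) CW
          by (auto simp: set_compositions_iff)
      then show "(hd ((q \<union> hd P) # tl P) - q) # tl ((q \<union> hd P) # tl P) = P"
        using CW by auto
      have "(q \<union> C) # W \<in> set_compositions B"
        using P(1) CW Cq q by (auto simp: set_compositions_iff)
      moreover have "q # Q \<preceq> (q \<union> C) # W"
        using P(3) CW unfolding refines_def by auto
      ultimately show "(q \<union> hd P) # tl P \<in> Va"
        using CW P(2) by (simp add: Va_def V_def anchored_def)
    qed
    also have "\<dots> = e_set q \<curlyvee> x"
      unfolding x_def e_set_wedge_e_comp[OF Q finite_Diff[OF fin]] V'_def vee_linear ..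
    finally show ?thesis .
  qed
  moreover have "sum f Vb = - (x \<curlyvee> e_set q)"
  proof -
    have "sum f Vb = (\<Sum>P \<in> V'. - scale (block_sign P) (e_comp (meet_comp P Q) \<curlyvee> e_set q))"
    proof (rule sum.reindex_bij_witness[where i = "\<lambda>P. P @ [q]" and j = butlast])
      fix P assume "P \<in> Vb"
      then have P: "P \<in> V" "last P = q" by (auto simp: Vb_def)
      then obtain W where W: "P = W @ [q]" using V(4)[OF P(1)] by (metis append_butlast_last_id)
      then show "butlast P @ [q] = P" by simp
      have "W \<noteq> []" using V(5)[OF P(1)] W min by auto
      have Wq: "\<And>Y. Y \<in> set W \<Longrightarrow> Y \<inter> q = {}" and WB: "W \<in> set_compositions (B - q)"
        using V(1)[OF P(1)] W by (auto simp: set_compositions_iff sorted_wrt_append)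
      have "Q \<preceq> W"
        unfolding refines_def
      proof
        fix Y assume Y: "Y \<in> set Q"
        then obtain Z where "Z \<in> set W \<or> Z = q" "Y \<subseteq> Z"
          using refines_block[OF V(3)[OF P(1)], of Y] W by auto
        moreover have "\<not> Y \<subseteq> q" using disj[OF Y] neQ Y by (metis Int_absorb2)
        ultimately show "\<exists>Z \<in> set W. Y \<subseteq> Z" by auto
      qed
      with WB V(5)[OF P(1)] W \<open>W \<noteq> []\<close> show "butlast P \<in> V'"
        by (simp add: V'_def anchored_def minq)
      have "meet_comp W (q # Q) = meet_comp W Q"
        using Wq by (intro meet_comp_cong) auto
      moreover have "trace_on q Q = []"
        using disj by (intro trace_on_disjoint) blast
      ultimately have "meet_comp P (q # Q) = meet_comp W Q @ [q]"
        using W q by simp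
      moreover have "block_sign P = (- block_sign W :: 'f)"
        using W \<open>W \<noteq> []\<close> by (cases W) (auto simp: block_sign_def)
      ultimately show "- scale (block_sign (butlast P)) (e_comp (meet_comp (butlast P) Q) \<curlyvee> e_set q) =
          f P"
        using W by (simp add: f_def e_comp_append comb.scale_minus_left)
    next
      fix P assume "P \<in> V'"
      then have P: "P \<in> set_compositions (B - q)" "Min B \<in> hd P" "Q \<preceq> P"
        by (auto simp: V'_def anchored_def minq)
      show "butlast (P @ [q]) = P" by simp
      have "P \<noteq> []" using P(1) Bq by (auto simp: set_compositions_iff)
      have "P @ [q] \<in> set_compositions B"
        using append_in_set_compositions[OF P(1), of "[q]" q] q by (simp add: Un_absorb2 Int_commute)
      moreover have "q # Q \<preceq> P @ [q]"
        using P(3) unfolding refines_def by auto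
      ultimately show "P @ [q] \<in> Vb"
        using P(2) \<open>P \<noteq> []\<close> by (simp add: Vb_def V_def anchored_def)
    qed
    also have "\<dots> = - (x \<curlyvee> e_set q)"
      unfolding x_def e_set_wedge_e_comp[OF Q finite_Diff[OF fin]] V'_def vee_linear sum_negf ..
    finally show ?thesis .
  qed
  ultimately show ?thesis
    using split unfolding e_set_wedge_e_comp[OF qQ fin] f_def[symmetric] V_def[symmetric] by simp
qed

section \<open>Orthogonal idempotents\<close>

lemma distinct_set_compositions: "P \<in> set_compositions A \<Longrightarrow> distinct P"
  by (simp add: set_compositions_def)

lemma length_set_compositions: "P \<in> set_compositions A \<Longrightarrow> length P = card (set P)"
  by (simp add: distinct_card distinct_set_compositions)

lemma set_compositions_singleton:
  assumes "P \<in> set_compositions A" "set P = {X}"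
  shows "P = [X]"
proof -
  have "length P = 1" using length_set_compositions[OF assms(1)] assms(2) by simp
  with assms(2) show ?thesis by (cases P) auto
qed

lemma nonempty_block: "P \<in> set_compositions A \<Longrightarrow> X \<in> set P \<Longrightarrow> X \<noteq> {}"
  by (auto simp: set_compositions_iff)

lemma block_eqI:
  assumes "P \<in> set_compositions A" "X \<in> set P" "Y \<in> set P" "X \<subseteq> Y"
  shows "X = Y"
  using disjoint_blocks[OF assms(1-3)] nonempty_block[OF assms(1,2)] assms(4) by blast

lemma meet_comp_same_blocks:
  assumes "P \<in> set_compositions A" "Q \<in> set_compositions A" "set P = set Q"
  shows "meet_comp P Q = P"
proof -
  have "trace_on X Q = [X]" if X: "X \<in> set Q" for X
  proof -
    have "X \<subseteq> A" "X \<noteq> {}" using assms(2) X by (auto simp: set_compositions_iff)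
    then have "meet_comp [X] Q \<in> set_compositions X"
      using meet_comp_in_set_compositions[of "[X]" X, OF _ assms(2)] by (simp add: Int_absorb2)
    moreover have "set (trace_on X Q) = {X}"
      using X \<open>X \<noteq> {}\<close> disjoint_blocks[OF assms(2) X] by (fastforce simp: set_trace_on)
    ultimately show ?thesis
      using set_compositions_singleton by auto
  qed
  then have "meet_comp R Q = R" if "set R \<subseteq> set Q" for R
    using that by (induction R) auto
  with assms(3) show ?thesis by simp
qed

text \<open>
  The map that sends a component of \<open>Q\<close> to the component of \<open>R\<close> around it is onto, and it is
  injective if the lengths agree.
\<close>

lemma refines_length:
  assumes R: "R \<in> set_compositions A" and Q: "Q \<in> set_compositions A" and ref: "Q \<preceq> R"
  shows "length R \<le> length Q" "length R = length Q \<Longrightarrow> set R = set Q"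
proof -
  define f where "f Y = (SOME X. X \<in> set R \<and> Y \<subseteq> X)" for Y
  have f: "f Y \<in> set R" "Y \<subseteq> f Y" if "Y \<in> set Q" for Y
  proof -
    have "\<exists>X. X \<in> set R \<and> Y \<subseteq> X" using ref that by (auto simp: refines_def)
    then have "f Y \<in> set R \<and> Y \<subseteq> f Y" unfolding f_def by (rule someI_ex)
    then show "f Y \<in> set R" "Y \<subseteq> f Y" by auto
  qed
  have meets: "\<exists>Y \<in> set Q. x \<in> Y \<and> f Y = X" if "X \<in> set R" "x \<in> X" for X x
  proof -
    have "x \<in> \<Union>(set Q)" using R Q that by (auto simp: set_compositions_iff)
    then obtain Y where Y: "Y \<in> set Q" "x \<in> Y" by blast
    then have "f Y = X" using f[OF Y(1)] disjoint_blocks[OF R f(1)[OF Y(1)] that(1)] that(2) by blast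
    with Y show ?thesis by blast
  qed
  have img: "f ` set Q = set R"
  proof
    show "set R \<subseteq> f ` set Q"
    proof
      fix X assume X: "X \<in> set R"
      then obtain x where "x \<in> X" using nonempty_block[OF R] by blast
      with meets[OF X] show "X \<in> f ` set Q" by blast
    qed
  qed (use f in auto)
  then have "card (set R) \<le> card (set Q)" using card_image_le[of "set Q" f] by simp
  then show "length R \<le> length Q"
    using length_set_compositions[OF R] length_set_compositions[OF Q] by simp
  assume "length R = length Q"
  then have card: "card (set R) = card (set Q)"
    using length_set_compositions[OF R] length_set_compositions[OF Q] by simp
  then have inj: "inj_on f (set Q)"
    using img by (intro eq_card_imp_inj_on) auto
  have "set R \<subseteq> set Q"
  proof
    fix X assume X: "X \<in> set R"
    then obtain x where "x \<in> X" using nonempty_block[OF R] by blast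
    with meets[OF X] obtain Y where Y: "Y \<in> set Q" "f Y = X" by blast
    have "X \<subseteq> Y"
    proof
      fix x' assume "x' \<in> X"
      with meets[OF X] obtain Y' where "Y' \<in> set Q" "x' \<in> Y'" "f Y' = X" by blast
      with inj Y show "x' \<in> Y" by (auto dest: inj_onD)
    qed
    with f[OF Y(1)] Y have "X = Y" by auto
    with Y show "X \<in> set Q" by simp
  qed
  with card show "set R = set Q" by (intro card_subset_eq) auto
qed

lemma refines_cong: "set Q = set Q' \<Longrightarrow> Q \<preceq> R \<longleftrightarrow> Q' \<preceq> R"
  by (simp add: refines_def)

lemma refines_cong_right: "set R = set R' \<Longrightarrow> Q \<preceq> R \<longleftrightarrow> Q \<preceq> R'"
  by (simp add: refines_def)

lemma refines_refl_set: "set Q = set R \<Longrightarrow> Q \<preceq> R"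
  by (auto simp: refines_def)

lemma refines_trans: "P \<preceq> Q \<Longrightarrow> Q \<preceq> R \<Longrightarrow> P \<preceq> R"
  unfolding refines_def by (meson order_trans)

lemma exists_unshared_block:
  assumes R: "R \<in> set_compositions A" and Q: "Q \<in> set_compositions A" and ref: "Q \<preceq> R"
    and "set R \<noteq> set Q"
  obtains B where "B \<in> set R" "B \<notin> set Q"
proof -
  have "\<not> set R \<subseteq> set Q"
  proof
    assume sub: "set R \<subseteq> set Q"
    have "set Q \<subseteq> set R"
    proof
      fix Y assume Y: "Y \<in> set Q"
      then obtain X where "X \<in> set R" "Y \<subseteq> X" using refines_block[OF ref] by blast
      with block_eqI[OF Q Y, of X] sub show "Y \<in> set R" by auto
    qed
    with sub assms(4) show False by simp
  qed
  then show thesis using that by blast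
qed

lemma glue_in_set_compositions:
  assumes "R \<in> set_compositions A" "\<phi> \<in> choices R"
  shows "glue R \<phi> \<in> set_compositions A" "glue R \<phi> \<preceq> R"
proof -
  have \<phi>: "\<phi> B \<in> set_compositions B" if "B \<in> set R" for B
    using PiE_mem[OF assms(2) that] by (simp add: anchored_def)
  from assms(1) this show "glue R \<phi> \<in> set_compositions A"
  proof (induction R arbitrary: A)
    case (Cons B R)
    then have "glue R \<phi> \<in> set_compositions (\<Union>(set R))" "\<phi> B \<in> set_compositions B"
      unfolding set_compositions_Cons_iff by auto
    with Cons.prems(1) show ?case
      using append_in_set_compositions[of "\<phi> B" B "glue R \<phi>"]
      by (simp add: glue_def set_compositions_Cons_iff)
  qed (simp add: glue_def)
  show "glue R \<phi> \<preceq> R"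
    unfolding refines_def
  proof
    fix X assume "X \<in> set (glue R \<phi>)"
    then obtain B where "B \<in> set R" "X \<in> set (\<phi> B)" by (auto simp: glue_def)
    moreover from this have "X \<subseteq> B" using \<phi>[of B] by (auto simp: set_compositions_iff)
    ultimately show "\<exists>Y \<in> set R. X \<subseteq> Y" by blast
  qed
qed

lemma e_comp_wedge_e_comp_eq_0:
  assumes R: "R \<in> set_compositions A" and Q: "Q \<in> set_compositions A" and fin: "finite A"
    and "\<not> Q \<preceq> R"
  shows "e_comp R \<curlywedge> e_comp Q = (0 :: 'f::field comb)"
proof -
  have "basis (glue R \<phi>) \<curlywedge> e_comp Q = (0 :: 'f comb)" if "\<phi> \<in> choices R" for \<phi>
    using glue_in_set_compositions[OF R that] assms(4) refines_trans
    by (intro basis_wedge_e_comp_not_refines[OF _ Q fin]) auto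
  then show ?thesis
    by (simp add: e_comp_expansion[OF R fin] wedge_linear)
qed

lemma e_set_wedge_self:
  assumes "finite B" "B \<noteq> {}"
  shows "e_set B \<curlywedge> e_set B = (e_set B :: 'f::field comb)"
proof -
  have B: "[B] \<in> set_compositions B" using assms(2) by simp
  have "P = [B]" if PB: "P \<in> set_compositions B" and ref: "[B] \<preceq> P" for P
  proof -
    obtain X where X: "X \<in> set P" "B \<subseteq> X" using ref by (auto simp: refines_def)
    with PB have "X = B" by (auto simp: set_compositions_iff)
    moreover have "Y = X" if Y: "Y \<in> set P" for Y
    proof -
      have "Y \<subseteq> X"
        using Y \<open>P \<in> set_compositions B\<close> X(2) by (auto simp: set_compositions_iff)
      then show ?thesis
        by (rule block_eqI[OF \<open>P \<in> set_compositions B\<close> Y X(1)])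
    qed
    ultimately have "set P = {B}" using X by blast
    with PB show ?thesis by (rule set_compositions_singleton)
  qed
  moreover have "[B] \<in> anchored B" "[B] \<preceq> [B]"
    using assms B by (auto simp: anchored_def refines_def)
  ultimately have "{P \<in> anchored B. [B] \<preceq> P} = {[B]}"
    by (auto simp: anchored_def)
  moreover have "meet_comp [B] [B] = [B]" using assms by simp
  ultimately have "e_set B \<curlywedge> e_comp [B] = (scale (block_sign [B]) (e_comp [B]) :: 'f comb)"
    using e_set_wedge_e_comp[OF B assms(1)] by simp
  then show ?thesis by (simp add: block_sign_def)
qed

lemma blocks_in_own_block:
  assumes "Q \<in> set_compositions A" "B \<in> set Q"
  shows "blocks_in B Q = [B]"
proof -
  have "set (blocks_in B Q) = {B}" using block_eqI[OF assms(1)] assms(2) by auto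
  moreover have "distinct (blocks_in B Q)" using distinct_set_compositions[OF assms(1)] by simp
  ultimately have "length (blocks_in B Q) = 1" using distinct_card by fastforce
  with \<open>set (blocks_in B Q) = {B}\<close> show ?thesis by (cases "blocks_in B Q") auto
qed

text \<open>
  By factorisation this reduces to \<open>e_set B \<curlywedge> e_set B = e_set B\<close>. In particular the elements
  \<open>e_comp R\<close> are idempotent, and they generate the same left ideals as their rearrangements.
\<close>

lemma e_comp_wedge_same_blocks:
  assumes R: "R \<in> set_compositions A" and Q: "Q \<in> set_compositions A" and fin: "finite A"
    and eq: "set R = set Q"
  shows "e_comp R \<curlywedge> e_comp Q = (e_comp R :: 'f::field comb)"
proof -
  have "e_set B \<curlywedge> e_comp (blocks_in B Q) = (e_set B :: 'f comb)" if "B \<in> set R" for B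
  proof -
    have B: "B \<in> set Q" using that eq by simp
    show ?thesis
      unfolding blocks_in_own_block[OF Q B] e_comp_singleton
      by (rule e_set_wedge_self[OF block_facts(3,1)[OF Q fin B]])
  qed
  then have eq': "map (\<lambda>B. e_set B \<curlywedge> e_comp (blocks_in B Q) :: 'f comb) R = map e_set R"
    by simp
  have "Q \<preceq> R" by (rule refines_refl_set) (simp add: eq)
  show ?thesis
    unfolding e_comp_wedge_e_comp[OF R Q fin \<open>Q \<preceq> R\<close>] eq' by (simp only: e_comp_vees)
qed

lemma inj_on_Min:
  assumes "Q \<in> set_compositions A" "finite A"
  shows "inj_on Min (set Q)"
proof (rule inj_onI)
  fix X Y assume XY: "X \<in> set Q" "Y \<in> set Q" "Min X = Min Y"
  then have "Min X \<in> X \<inter> Y" using block_facts(4)[OF assms XY(1)] block_facts(4)[OF assms XY(2)] by simp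
  with disjoint_blocks[OF assms(1) XY(1,2)] show "X = Y" by blast
qed

lemma ordered_unique:
  assumes "T \<in> ordered_set_compositions A" "T' \<in> ordered_set_compositions A" "finite A"
    and "set T = set T'"
  shows "T = T'"
proof -
  have T: "T \<in> set_compositions A" using assms(1) by (simp add: ordered_set_compositions_def)
  have "map Min T = map Min T'"
    using assms by (intro strict_sorted_equal) (auto simp: ordered_set_compositions_def)
  then show ?thesis
    by (rule map_inj_on) (simp add: inj_on_Min[OF T assms(3)] flip: assms(4))
qed

lemma ordered_exists:
  assumes "Q \<in> set_compositions A" "finite A"
  obtains T where "T \<in> ordered_set_compositions A" "set T = set Q"
proof
  let ?T = "sort_key Min Q"
  show "set ?T = set Q" by simp
  have "distinct (map Min ?T)"
    using inj_on_Min[OF assms] distinct_set_compositions[OF assms(1)] by (simp add: distinct_map)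
  moreover have "sorted (map Min ?T)" by simp
  ultimately have "sorted_wrt (<) (map Min ?T)"
    by (simp only: strict_sorted_iff)
  moreover have "?T \<in> set_compositions A"
    using assms(1) by (simp add: set_compositions_def)
  ultimately show "?T \<in> ordered_set_compositions A"
    by (simp add: ordered_set_compositions_def)
qed

text \<open>
  If \<open>T'\<close> refines \<open>T\<close>, then some component \<open>B\<close> of \<open>T\<close> is a union of at least two components of
  \<open>T'\<close>. Since \<open>T'\<close> is ordered, the minimum of \<open>B\<close> lies in the first of these and not in the last,
  so the factor of the product that belongs to \<open>B\<close> is \<open>0\<close>.
\<close>

lemma e_comp_orthogonal:
  assumes T: "T \<in> ordered_set_compositions A" and T': "T' \<in> ordered_set_compositions A"
    and fin: "finite A" and "T \<noteq> T'"
  shows "e_comp T \<curlywedge> e_comp T' = (0 :: 'f::field comb)"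
proof (cases "T' \<preceq> T")
  case True
  have TA: "T \<in> set_compositions A" "T' \<in> set_compositions A" and sorted: "sorted_wrt (<) (map Min T')"
    using T T' by (auto simp: ordered_set_compositions_def)
  have "set T \<noteq> set T'" using ordered_unique[OF T T' fin] assms(4) by blast
  then obtain B where B: "B \<in> set T" "B \<notin> set T'"
    using exists_unshared_block[OF TA True] by blast
  note Bf = block_facts[OF TA(1) fin B(1)]
  have Y: "blocks_in B T' \<in> set_compositions B"
    using refines_dichotomy[OF TA(1) True B(1)] Bf by (intro blocks_in_set_compositions[OF TA(2)]) auto
  have "blocks_in B T' \<noteq> []"
  proof
    assume "blocks_in B T' = []"
    with Y Bf(1) show False by (simp only: set_compositions_iff) simp
  qed
  then obtain W S where WS: "blocks_in B T' = W @ [S]" by (metis append_butlast_last_id)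
  have "W \<noteq> []"
  proof
    assume "W = []"
    then have "S = B" using Y WS by (auto simp: set_compositions_iff)
    moreover have "S \<in> set (blocks_in B T')" using WS by simp
    ultimately show False using B(2) by simp
  qed
  then obtain h W' where h: "W = h # W'" by (cases W) auto
  have "sorted_wrt (<) (map Min (W @ [S]))"
    using sorted unfolding WS[symmetric] by (simp add: sorted_wrt_map sorted_wrt_filter)
  then have "Min h < Min S" using h by (simp add: sorted_wrt_append)
  moreover have "Min B \<le> Min h"
    using Y WS h Bf by (intro Min_antimono) (auto simp: set_compositions_iff)
  moreover have "finite S" using Y WS Bf finite_subset by (auto simp: set_compositions_iff)
  ultimately have "Min B \<notin> S" using Min_le[of S "Min B"] by linarith
  then have "e_set B \<curlywedge> e_comp (blocks_in B T') = (0 :: 'f comb)"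
    using Y Bf unfolding WS by (intro e_set_wedge_e_comp_eq_0) auto
  then show ?thesis
    unfolding e_comp_wedge_e_comp[OF TA fin True] using B by (intro vees_zero) (force simp: image_iff)
next
  case False
  with T T' show ?thesis
    by (intro e_comp_wedge_e_comp_eq_0[OF _ _ fin]) (auto simp: ordered_set_compositions_def)
qed

lemma length_le_card:
  assumes "P \<in> set_compositions A" "finite A"
  shows "length P \<le> card A"
proof -
  have "Min ` set P \<subseteq> A" using block_facts[OF assms] by blast
  then show ?thesis
    using card_inj_on_le[OF inj_on_Min[OF assms] _ assms(2)] length_set_compositions[OF assms(1)] by simp
qed

text \<open>
  The expansion of \<open>e_comp P\<close> is unitriangular: \<open>P\<close> occurs with coefficient \<open>1\<close>, and all other
  terms are longer.
\<close>

lemma basis_in_span_e_comp: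
  assumes "P \<in> set_compositions A" "finite A"
  shows "basis P \<in> comb.span (e_comp ` set_compositions A :: 'f::field comb set)"
  using assms(1)
proof (induction "card A - length P" arbitrary: P rule: less_induct)
  case less
  \<comment> \<open>The trivial choice \<open>e_set B = [B] + \<dots>\<close> for every \<open>B\<close> yields \<open>P\<close> itself.\<close>
  define \<phi>\<^sub>0 where "\<phi>\<^sub>0 = (\<lambda>B \<in> set P. [B])"
  define c where "c \<phi> = (\<Prod>B \<in> set P. block_sign (\<phi> B) :: 'f)" for \<phi>
  have \<phi>0: "\<phi>\<^sub>0 \<in> choices P"
    using block_facts[OF less.prems assms(2)] by (auto simp: \<phi>\<^sub>0_def anchored_def)
  have "map \<phi>\<^sub>0 P = map (\<lambda>B. [B]) P" by (simp add: \<phi>\<^sub>0_def)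
  then have glue0: "glue P \<phi>\<^sub>0 = P" by (simp only: glue_def concat_map_singleton map_ident)
  have c0: "c \<phi>\<^sub>0 = 1" by (simp add: c_def \<phi>\<^sub>0_def block_sign_def)
  have "e_comp P = scale (c \<phi>\<^sub>0) (basis (glue P \<phi>\<^sub>0)) +
      (\<Sum>\<phi> \<in> choices P - {\<phi>\<^sub>0}. scale (c \<phi>) (basis (glue P \<phi>)))"
    unfolding e_comp_expansion[OF less.prems assms(2)] c_def
    by (intro sum.remove finite_choices[OF less.prems assms(2)] \<phi>0)
  then have "basis P = e_comp P - (\<Sum>\<phi> \<in> choices P - {\<phi>\<^sub>0}. scale (c \<phi>) (basis (glue P \<phi>)))"
    by (simp add: glue0 c0)
  moreover have "basis (glue P \<phi>) \<in> comb.span (e_comp ` set_compositions A :: 'f comb set)"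
    if \<phi>: "\<phi> \<in> choices P - {\<phi>\<^sub>0}" for \<phi>
  proof -
    have \<phi>P: "\<phi> \<in> choices P" using \<phi> by simp
    note g = glue_in_set_compositions[OF less.prems \<phi>P]
    have "length P \<noteq> length (glue P \<phi>)"
    proof
      assume "length P = length (glue P \<phi>)"
      then have eq: "set P = set (glue P \<phi>)" using refines_length(2)[OF less.prems g] by simp
      have "\<phi> B = [B]" if B: "B \<in> set P" for B
      proof -
        have \<phi>B: "\<phi> B \<in> set_compositions B" using PiE_mem[OF \<phi>P B] by (simp add: anchored_def)
        have "X = B" if X: "X \<in> set (\<phi> B)" for X
        proof -
          have "X \<in> set P" using eq X B by (auto simp: glue_def)
          moreover have "X \<subseteq> B" using \<phi>B X by (auto simp: set_compositions_iff)
          ultimately show ?thesis using block_eqI[OF less.prems _ B] by blast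
        qed
        moreover obtain X where "X \<in> set (\<phi> B)"
          using \<phi>B nonempty_block[OF less.prems B] by (auto simp: set_compositions_iff)
        ultimately have "set (\<phi> B) = {B}" by blast
        then show ?thesis by (rule set_compositions_singleton[OF \<phi>B])
      qed
      then have "\<phi> = \<phi>\<^sub>0"
        using \<phi>P \<phi>0 by (intro PiE_ext[OF \<phi>P \<phi>0]) (simp add: \<phi>\<^sub>0_def)
      with \<phi> show False by simp
    qed
    with refines_length(1)[OF less.prems g] length_le_card[OF g(1) assms(2)]
    show ?thesis by (intro less.hyps g(1)) linarith
  qed
  ultimately show ?case
    using less.prems
        by (auto intro!: comb.span_diff comb.span_sum comb.span_scale intro: comb.span_base)
qed

text \<open>
  The identity of the algebra. As \<open>[{}]\<close> is not a set composition, it is the empty list for empty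
  \<open>A\<close>.
\<close>

definition comp_one :: "nat set \<Rightarrow> 'f::field comb" where
  "comp_one A = basis (if A = {} then [] else [A])"

lemma comp_one_in_comp_algebra: "comp_one A \<in> comp_algebra A"
  by (auto simp: comp_one_def set_compositions_iff)

lemma comp_one_wedge:
  assumes "p \<in> comp_algebra A"
  shows "comp_one A \<curlywedge> p = (p :: 'f::field comb)"
  using assms
proof (induction rule: comp_algebra_induct)
  case (basis P)
  have "trace_on A R = R" if "{} \<notin> set R" "\<Union>(set R) \<subseteq> A" for R
    using that by (induction R) (auto simp: Int_absorb1)
  moreover have "A = {} \<Longrightarrow> P = []"
    using basis by (cases P) (auto simp: set_compositions_iff)
  ultimately show ?case
    using basis by (auto simp: comp_one_def set_compositions_iff)
qed (simp_all add: wedge_right.add wedge_linear)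

lemma finite_ordered: "finite A \<Longrightarrow> finite (ordered_set_compositions A)"
  by (simp add: ordered_set_compositions_def finite_set_compositions)

text \<open>
  Orthogonality makes the sum \<open>s\<close> a right identity for all \<open>e_comp Q\<close>. These span the algebra, so
  \<open>s\<close> is a right identity, and it equals \<open>1 \<curlywedge> s = 1\<close>.
\<close>

lemma sum_e_comp_ordered:
  assumes fin: "finite A"
  shows "(\<Sum>T \<in> ordered_set_compositions A. e_comp T) = (comp_one A :: 'f::field comb)"
proof -
  define s :: "'f comb" where "s = (\<Sum>T \<in> ordered_set_compositions A. e_comp T)"
  have e_s: "e_comp Q \<curlywedge> s = e_comp Q" if Q: "Q \<in> set_compositions A" for Q
  proof -
    obtain T where T: "T \<in> ordered_set_compositions A" "set T = set Q"
      using ordered_exists[OF Q fin] .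
    have eQ: "e_comp Q = e_comp Q \<curlywedge> (e_comp T :: 'f comb)"
      using T by (intro e_comp_wedge_same_blocks[OF Q _ fin, symmetric])
        (auto simp: ordered_set_compositions_def)
    have "e_comp Q \<curlywedge> e_comp T' = (if T' = T then e_comp Q else 0 :: 'f comb)"
      if "T' \<in> ordered_set_compositions A" for T'
    proof (cases "T' = T")
      case False
      then have "e_comp T \<curlywedge> e_comp T' = (0 :: 'f comb)"
        using e_comp_orthogonal[OF T(1) that fin] by simp
      then show ?thesis using False by (subst eQ) (simp add: wedge_assoc)
    qed (use eQ in simp)
    then have "e_comp Q \<curlywedge> s = (\<Sum>T' \<in> ordered_set_compositions A. if T' = T then e_comp Q else 0)"
      by (simp add: s_def wedge_linear)
    then show ?thesis using T finite_ordered[OF fin] by simp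
  qed
  have "p \<curlywedge> s = p" if "p \<in> comb.span (e_comp ` set_compositions A)" for p
    using that
  proof (induction rule: comb.span_induct_alt)
    case (step c x y)
    then show ?case using e_s by (auto simp: wedge_left.add wedge_linear)
  qed simp
  moreover have "comp_one A \<in> comb.span (e_comp ` set_compositions A :: 'f comb set)"
    unfolding comp_one_def using fin by (intro basis_in_span_e_comp) (auto simp: set_compositions_iff)
  moreover have "s \<in> comp_algebra A"
    unfolding s_def
    by (intro comp_algebra_closed e_comp_in_comp_algebra) (simp add: ordered_set_compositions_def)
  ultimately show ?thesis
    using comp_one_wedge[of s A] by (simp add: s_def)
qed

section \<open>Generation by commutators\<close>

lemma ordered_is_composition: "T \<in> ordered_set_compositions A \<Longrightarrow> T \<in> set_compositions A"
  by (simp add: ordered_set_compositions_def)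

lemma vees_map_split:
  "vees (map g (U @ B # V)) = vees (map g U) \<curlyvee> g B \<curlyvee> (vees (map g V) :: 'f::field comb)"
  by (simp add: vees_append)

text \<open>
  A component \<open>B\<close> of \<open>R\<close> that is not a component of \<open>Q\<close> carries a Lie polynomial of degree at least
  two. It vanishes or is a commutator \<open>[e_set q, x]\<close>, and a commutator is the effect of exchanging
  two adjacent components \<open>q\<close> and \<open>B - q\<close> that refine \<open>B\<close>.
\<close>

lemma e_comp_wedge_bracket:
  assumes R: "R \<in> set_compositions A" and Q: "Q \<in> set_compositions A" and fin: "finite A"
    and ref: "Q \<preceq> R" and less: "length R < length Q"
  obtains "e_comp R \<curlywedge> e_comp Q = (0 :: 'f::field comb)"
  | R' R'' where "R' \<in> set_compositions A" "R'' \<in> set_compositions A" "set R' = set R''"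
      "Q \<preceq> R'" "length R' = Suc (length R)"
      "e_comp R \<curlywedge> e_comp Q = (basis R' - basis R'') \<curlywedge> (e_comp R' \<curlywedge> e_comp Q :: 'f comb)"
proof -
  have "set R \<noteq> set Q"
    using less length_set_compositions[OF R] length_set_compositions[OF Q] by auto
  then obtain B where B: "B \<in> set R" "B \<notin> set Q"
    using exists_unshared_block[OF R Q ref] by blast
  then obtain U V where UV: "R = U @ B # V" by (meson split_list)
  note Bf = block_facts[OF R fin B(1)]
  define Y where "Y = blocks_in B Q"
  have Y: "Y \<in> set_compositions B"
    unfolding Y_def using refines_dichotomy[OF R ref B(1)] Bf
        by (intro blocks_in_set_compositions[OF Q]) auto
  have "B \<notin> set Y" using B(2) by (simp add: Y_def)
  have "Y \<noteq> []"
  proof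
    assume "Y = []"
    with Y Bf(1) show False by (simp add: set_compositions_iff)
  qed
  then obtain q Z where qZ: "Y = q # Z" by (cases Y) auto
  have "Z \<noteq> []"
  proof
    assume "Z = []"
    with Y qZ have "q = B" by (simp add: set_compositions_iff)
    with qZ \<open>B \<notin> set Y\<close> show False by simp
  qed
  have qB: "q \<noteq> {}" "q \<subseteq> B" "q \<in> set Q" and Zq: "\<And>X. X \<in> set Z \<Longrightarrow> q \<inter> X = {}"
    and Z: "Z \<in> set_compositions (B - q)" and Zne: "{} \<notin> set Z"
  proof -
    show "q \<noteq> {}" "q \<subseteq> B" "\<And>X. X \<in> set Z \<Longrightarrow> q \<inter> X = {}" "{} \<notin> set Z"
      "Z \<in> set_compositions (B - q)"
      using Y unfolding qZ by (auto simp: set_compositions_iff)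
    have "q \<in> set Y" using qZ by simp
    then show "q \<in> set Q" by (simp add: Y_def)
  qed
  define g :: "nat set \<Rightarrow> 'f comb" where "g D = e_set D \<curlywedge> e_comp (blocks_in D Q)" for D
  have RQ: "e_comp R \<curlywedge> e_comp Q = vees (map g U) \<curlyvee> g B \<curlyvee> vees (map g V)"
    unfolding e_comp_wedge_e_comp[OF R Q fin ref] g_def[symmetric] by (simp only: UV vees_map_split)
  show thesis
  proof (cases "Min B \<in> q")
    case True
    obtain W S where WS: "Z = W @ [S]" using \<open>Z \<noteq> []\<close> by (metis append_butlast_last_id)
    then have "Min B \<notin> S" using Zq[of S] True by auto
    then have "g B = 0"
      using e_set_wedge_e_comp_eq_0[of "q # W" S B] Y qZ WS Bf(3) by (simp add: g_def flip: Y_def)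
    then have "e_comp R \<curlywedge> e_comp Q = (0 :: 'f comb)" by (simp add: RQ)
    then show thesis by (rule that(1))
  next
    case False
    define x :: "'f comb" where "x = e_set (B - q) \<curlywedge> e_comp Z"
    have gB: "g B = (e_set q \<curlyvee> x) - (x \<curlyvee> e_set q)"
      unfolding g_def Y_def[symmetric] qZ x_def
      by (rule e_set_wedge_e_comp_bracket[OF Y[unfolded qZ] Bf(3) False])
    define R' where "R' = U @ q # (B - q) # V"
    define R'' where "R'' = U @ (B - q) # q # V"
    have "B - q \<noteq> {}" using False Bf(4) by blast
    moreover have "X \<inter> q = {}" "X \<inter> (B - q) = {}" if "X \<inter> B = {}" for X
      using that qB by auto

    ultimately have R'A: "R' \<in> set_compositions A" and R''A: "R'' \<in> set_compositions A"
      using R qB unfolding R'_def R''_def UV set_compositions_iff sorted_wrt_append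
      by (simp_all add: Int_commute) (elim conjE, use qB(2) in blast)+
    have eq: "set R' = set R''" by (auto simp: R'_def R''_def)
    have ref': "Q \<preceq> R'"
      unfolding refines_def
    proof
      fix X assume X: "X \<in> set Q"
      show "\<exists>D \<in> set R'. X \<subseteq> D"
      proof (cases "X \<subseteq> B")
        case True
        then have "X \<in> set Y" using X by (simp add: Y_def)
        then have "X = q \<or> X \<subseteq> B - q"
          using Z qZ by (auto simp: set_compositions_iff)
        then show ?thesis by (auto simp: R'_def)
      next
        case False
        obtain D where "D \<in> set R" "X \<subseteq> D" using refines_block[OF ref X] by blast
        with False show ?thesis by (auto simp: R'_def UV)
      qed
    qed
    have gq: "g q = e_set q"
      unfolding g_def blocks_in_own_block[OF Q qB(3)] e_comp_singleton
      by (rule e_set_wedge_self[OF block_facts(3,1)[OF Q fin qB(3)]])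
    have "blocks_in (B - q) Q = blocks_in (B - q) Y"
      unfolding Y_def filter_filter by (intro filter_cong) auto
    also have "\<dots> = Z"
      using Z qB(1) by (auto simp: qZ set_compositions_iff intro!: filter_True)
    finally have gBq: "g (B - q) = x" by (simp add: g_def x_def)
    have R'Q: "e_comp R' \<curlywedge> e_comp Q = vees (map g U) \<curlyvee> e_set q \<curlyvee> x \<curlyvee> vees (map g V)"
      unfolding e_comp_wedge_e_comp[OF R'A Q fin ref'] g_def[symmetric]
      unfolding R'_def vees_map_split by (simp add: gq gBq)
    have ref'': "Q \<preceq> R''" using ref' refines_cong_right[OF eq] by simp
    have R''Q: "e_comp R'' \<curlywedge> e_comp Q = vees (map g U) \<curlyvee> x \<curlyvee> e_set q \<curlyvee> vees (map g V)"
      unfolding e_comp_wedge_e_comp[OF R''A Q fin ref''] g_def[symmetric]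
      unfolding R''_def vees_map_split by (simp add: gq gBq)
    have "e_comp R \<curlywedge> e_comp Q = (e_comp R' \<curlywedge> e_comp Q) - (e_comp R'' \<curlywedge> e_comp Q :: 'f comb)"
      unfolding RQ gB R'Q R''Q by (simp add: vee_left.diff vee_right.diff vee_assoc)
    moreover have "basis R' \<curlywedge> e_comp R' = (e_comp R' :: 'f comb)"
        "basis R'' \<curlywedge> e_comp R' = (e_comp R'' :: 'f comb)"
      using basis_wedge_e_comp_refines[OF R'A R'A fin] basis_wedge_e_comp_refines[OF R''A R'A fin]
        meet_comp_same_blocks[OF R'A R'A] meet_comp_same_blocks[OF R''A R'A] eq
      by (simp_all add: refines_refl_set)
    ultimately have "e_comp R \<curlywedge> e_comp Q = (basis R' - basis R'') \<curlywedge> (e_comp R' \<curlywedge> e_comp Q :: 'f comb)"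
      by (simp add: wedge_left.diff flip: wedge_assoc)
    then show thesis
      using R'A R''A eq ref' by (intro that(2)[of R' R'']) (auto simp: R'_def UV)
  qed
qed

section \<open>The layers of \<open>Lam A Q\<close>\<close>

lemma Lam_image: "Lam A Q = (\<lambda>p. p \<curlywedge> e_comp Q) ` comp_algebra A"
  by (auto simp: Lam_def)

lemma subspace_Lam: "comb.subspace (Lam A Q :: 'f::field comb set)"
  unfolding Lam_image by (rule wedge_left.subspace_image[OF subspace_comp_algebra])

lemma Lam_subset: "Q \<in> set_compositions A \<Longrightarrow> Lam A Q \<subseteq> comp_algebra A"
  by (auto simp: Lam_def intro!: wedge_in_comp_algebra e_comp_in_comp_algebra)

lemma wedge_in_Lam: "p \<in> comp_algebra A \<Longrightarrow> m \<in> Lam A Q \<Longrightarrow> p \<curlywedge> m \<in> Lam A Q"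
  unfolding Lam_def by (auto simp: wedge_assoc[symmetric] intro: wedge_in_comp_algebra)

lemma e_comp_in_Lam:
  assumes "Q' \<in> set_compositions A" "Q \<in> set_compositions A" "finite A" "set Q' = set Q"
  shows "e_comp Q' \<in> (Lam A Q :: 'f::field comb set)"
  unfolding Lam_image
  using e_comp_wedge_same_blocks[OF assms, symmetric] e_comp_in_comp_algebra[OF assms(1)]
  by (rule image_eqI)

lemma Lam_subset_span:
  assumes Q: "Q \<in> set_compositions A" and fin: "finite A"
  shows "Lam A Q \<subseteq> comb.span (e_comp ` {Q' \<in> set_compositions A. set Q' = set Q} :: 'f::field comb set)"
    (is "_ \<subseteq> ?S")
proof
  fix m :: "'f comb" assume "m \<in> Lam A Q"
  then obtain p where p: "p \<in> comp_algebra A" "m = p \<curlywedge> e_comp Q" by (auto simp: Lam_def)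
  from p(1) have "p \<curlywedge> e_comp Q \<in> ?S"
  proof (induction rule: comp_algebra_induct)
    case (basis P)
    have "meet_comp P Q \<in> set_compositions A"
      using meet_comp_in_set_compositions[OF basis Q] by simp
    then show ?case
      unfolding basis_wedge_e_comp[OF basis Q fin]
      using refines_iff_meet_comp[OF basis Q] by (auto intro!: comb.span_base comb.span_zero)
  qed (auto simp: wedge_left.add wedge_left.scale comb.span_zero intro: comb.span_add comb.span_scale)
  with p show "m \<in> ?S" by simp
qed

lemma e_comp_wedge_Lam_eq_0:
  assumes R: "R \<in> set_compositions A" and Q: "Q \<in> set_compositions A" and fin: "finite A"
    and "\<not> Q \<preceq> R" and m: "m \<in> Lam A Q"
  shows "e_comp R \<curlywedge> m = (0 :: 'f::field comb)"
proof -
  have "e_comp R \<curlywedge> e_comp Q' = (0 :: 'f comb)" if "Q' \<in> set_compositions A" "set Q' = set Q" for Q'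
    using assms(4) refines_cong[OF that(2)] by (intro e_comp_wedge_e_comp_eq_0[OF R that(1) fin]) auto
  then have "e_comp R \<curlywedge> x = 0"
    if "x \<in> e_comp ` {Q' \<in> set_compositions A. set Q' = set Q}" for x :: "'f comb"
    using that by blast
  moreover have "m \<in> comb.span (e_comp ` {Q' \<in> set_compositions A. set Q' = set Q})"
    using Lam_subset_span[OF Q fin] m by blast
  ultimately show ?thesis
    by (rule wedge_right.eq_0_on_span)
qed

lemma Lam_decomposition:
  assumes "Q \<in> set_compositions A" "finite A" "m \<in> Lam A Q"
  shows "m = (\<Sum>T \<in> ordered_set_compositions A. e_comp T \<curlywedge> m :: 'f::field comb)"
proof -
  have "m \<in> comp_algebra A" using Lam_subset[OF assms(1)] assms(3) by blast
  then have "m = comp_one A \<curlywedge> m" by (simp add: comp_one_wedge)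
  then show ?thesis
    unfolding sum_e_comp_ordered[OF assms(2), symmetric] wedge_left.sum .
qed

text \<open>
  The vanishing conditions single out the part \<open>\<Oplus> e_comp T \<curlywedge> Lam A Q\<close> with
  \<open>length T + j \<le> length Q\<close>. In this form membership is inherited by sums without choosing
  summands.
\<close>

definition layer :: "nat set \<Rightarrow> nat set list \<Rightarrow> nat \<Rightarrow> 'f::field comb set" where
  "layer A Q j = {m \<in> Lam A Q.
     \<forall>T \<in> ordered_set_compositions A. length Q < length T + j \<longrightarrow> e_comp T \<curlywedge> m = 0}"

context
  fixes A :: "nat set" and Q :: "nat set list"
  assumes fin: "finite A" and Q: "Q \<in> set_compositions A"
begin

lemma subspace_layer: "comb.subspace (layer A Q j :: 'f::field comb set)"
  by (rule comb.subspaceI)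
     (auto simp: layer_def wedge_right.add wedge_right.scale comb.subspace_0[OF subspace_Lam]
       intro: comb.subspace_add[OF subspace_Lam] comb.subspace_scale[OF subspace_Lam])

lemmas layer_closed = comb.subspace_0[OF subspace_layer] comb.subspace_add[OF subspace_layer]
  comb.subspace_scale[OF subspace_layer] comb.subspace_diff[OF subspace_layer]
  comb.subspace_sum[OF subspace_layer]

lemma layer_0: "layer A Q 0 = (Lam A Q :: 'f::field comb set)"
proof -
  have "e_comp T \<curlywedge> m = (0 :: 'f comb)"
    if "T \<in> ordered_set_compositions A" "length Q < length T" "m \<in> Lam A Q" for T m
  proof -
    have T: "T \<in> set_compositions A" using that(1) by (rule ordered_is_composition)
    have "\<not> Q \<preceq> T" using refines_length(1)[OF T Q] that(2) by auto
    then show ?thesis by (rule e_comp_wedge_Lam_eq_0[OF T Q fin _ that(3)])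
  qed
  then show ?thesis by (auto simp: layer_def)
qed

lemma layer_mono: "i \<le> j \<Longrightarrow> layer A Q j \<subseteq> (layer A Q i :: 'f::field comb set)"
  by (auto simp: layer_def)

lemma layer_eq_0: "length Q < j \<Longrightarrow> layer A Q j = {0 :: 'f::field comb}"
proof -
  assume "length Q < j"
  then have "m = 0" if "m \<in> layer A Q j" for m :: "'f comb"
    using that Lam_decomposition[OF Q fin, of m] by (auto simp: layer_def)
  then show ?thesis using layer_closed(1) by auto
qed

lemma e_comp_wedge_in_layer:
  assumes R: "R \<in> set_compositions A" and "length R + j \<le> length Q" and m: "m \<in> Lam A Q"
  shows "e_comp R \<curlywedge> m \<in> (layer A Q j :: 'f::field comb set)"
proof -
  have "e_comp T \<curlywedge> (e_comp R \<curlywedge> m) = 0"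
    if "T \<in> ordered_set_compositions A" "length Q < length T + j" for T
  proof -
    have T: "T \<in> set_compositions A" using that(1) by (rule ordered_is_composition)
    have "\<not> R \<preceq> T" using refines_length(1)[OF T R] that assms(2) by auto
    then have "e_comp T \<curlywedge> e_comp R = (0 :: 'f comb)"
      by (rule e_comp_wedge_e_comp_eq_0[OF T R fin])
    then show ?thesis by (simp flip: wedge_assoc)
  qed
  then show ?thesis
    using wedge_in_Lam[OF e_comp_in_comp_algebra[OF R] m] by (simp add: layer_def)
qed

text \<open>
  Decompose \<open>m\<close> into its parts \<open>e_comp T' \<curlywedge> m\<close>. Those with \<open>T'\<close> longer than \<open>T\<close> vanish in this
  layer, and \<open>P \<curlywedge> e_comp T'\<close> is \<open>0\<close> or \<open>e_comp\<close> of a rearrangement of \<open>T'\<close>, so that it is killed by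
  \<open>e_comp T\<close> unless \<open>T' \<preceq> T\<close>. Only \<open>T' = T\<close> remains.
\<close>

lemma e_comp_wedge_basis_wedge_layer:
  assumes T: "T \<in> ordered_set_compositions A" and P: "P \<in> set_compositions A"
    and m: "m \<in> layer A Q j" and len: "length Q \<le> length T + j"
  shows "e_comp T \<curlywedge> (basis P \<curlywedge> m) = (if T \<preceq> P then e_comp T \<curlywedge> m else 0 :: 'f::field comb)"
proof -
  have mL: "m \<in> Lam A Q" using m by (simp add: layer_def)
  have TA: "T \<in> set_compositions A" using T by (rule ordered_is_composition)
  have *: "e_comp T \<curlywedge> (basis P \<curlywedge> (e_comp T' \<curlywedge> m)) =
      (if T' = T then if T \<preceq> P then e_comp T \<curlywedge> m else 0 else 0)"
    if T': "T' \<in> ordered_set_compositions A" for T'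
  proof -
    have T'A: "T' \<in> set_compositions A" using T' by (rule ordered_is_composition)
    have M: "meet_comp P T' \<in> set_compositions A"
      using meet_comp_in_set_compositions[OF P T'A] by simp
    have eq: "e_comp T \<curlywedge> (basis P \<curlywedge> (e_comp T' \<curlywedge> m)) =
        e_comp T \<curlywedge> (if T' \<preceq> P then e_comp (meet_comp P T') else 0) \<curlywedge> m"
      unfolding basis_wedge_e_comp[OF P T'A fin, symmetric] wedge_assoc ..
    show ?thesis
    proof (cases "T' = T")
      case True
      have "e_comp T \<curlywedge> e_comp (meet_comp P T) = (e_comp T :: 'f comb)" if "T \<preceq> P"
      proof (rule e_comp_wedge_same_blocks[OF TA _ fin])
        show "meet_comp P T \<in> set_compositions A" using M True by simp
        show "set T = set (meet_comp P T)"
          using refines_iff_meet_comp[OF P TA] that by simp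
      qed
      with eq True show ?thesis by simp
    next
      case False
      show ?thesis
      proof (cases "length Q < length T' + j")
        case True
        then have "e_comp T' \<curlywedge> m = 0" using m T' by (simp add: layer_def)
        with False show ?thesis by simp
      next
        case False': False
        have "\<not> T' \<preceq> T"
        proof
          assume r: "T' \<preceq> T"
          with refines_length(1)[OF TA T'A r] len False' have "length T = length T'" by simp
          with refines_length(2)[OF TA T'A r] have "T = T'"
            by (intro ordered_unique[OF T T' fin]) simp
          with False show False by simp
        qed
        then have "e_comp T \<curlywedge> e_comp (meet_comp P T') = (0 :: 'f comb)" if "T' \<preceq> P"
          using refines_iff_meet_comp[OF P T'A] that refines_cong[of "meet_comp P T'" T' T]
          by (intro e_comp_wedge_e_comp_eq_0[OF TA M fin]) simp
        with False show ?thesis unfolding eq by simp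
      qed
    qed
  qed
  have "e_comp T \<curlywedge> (basis P \<curlywedge> m) =
      (\<Sum>T' \<in> ordered_set_compositions A. e_comp T \<curlywedge> (basis P \<curlywedge> (e_comp T' \<curlywedge> m)))"
    by (subst Lam_decomposition[OF Q fin mL]) (simp add: wedge_linear)
  also have "\<dots> = (\<Sum>T' \<in> ordered_set_compositions A. if T' = T then
      if T \<preceq> P then e_comp T \<curlywedge> m else 0 else 0)"
    using * by (intro sum.cong) auto
  finally show ?thesis
    using T finite_ordered[OF fin] by simp
qed

lemma wedge_in_layer:
  assumes "p \<in> comp_algebra A" and m: "m \<in> layer A Q j"
  shows "p \<curlywedge> m \<in> (layer A Q j :: 'f::field comb set)"
  using assms(1)
proof (induction rule: comp_algebra_induct)
  case (basis P)
  have mL: "m \<in> Lam A Q" using m by (simp add: layer_def)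
  have "e_comp T \<curlywedge> (basis P \<curlywedge> m) = 0"
      if "T \<in> ordered_set_compositions A" "length Q < length T + j" for T
    using e_comp_wedge_basis_wedge_layer[OF that(1) basis m] that m by (simp add: layer_def)
  then show ?case
    using wedge_in_Lam[OF _ mL, of "basis P"] basis by (simp add: layer_def)
qed (simp_all add: wedge_left.add wedge_left.scale layer_closed)

text \<open>
  Set compositions with the same components act by the same scalars on the parts that distinguish a
  layer from the next one.
\<close>

lemma basis_diff_wedge_in_next_layer:
  assumes R: "R \<in> set_compositions A" "R' \<in> set_compositions A" "set R = set R'"
    and m: "m \<in> layer A Q j"
  shows "(basis R - basis R') \<curlywedge> m \<in> (layer A Q (Suc j) :: 'f::field comb set)"
proof -
  have "(basis R - basis R') \<curlywedge> m \<in> layer A Q j"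
    using R by (intro wedge_in_layer[OF _ m] comp_algebra_closed) auto
  moreover have "e_comp T \<curlywedge> ((basis R - basis R') \<curlywedge> m) = 0"
    if "T \<in> ordered_set_compositions A" "length Q \<le> length T + j" for T
    unfolding wedge_left.diff wedge_right.diff e_comp_wedge_basis_wedge_layer[OF that(1) R(1) m that(2)]
      e_comp_wedge_basis_wedge_layer[OF that(1) R(2) m that(2)]
    using refines_cong_right[OF R(3)] by simp
  ultimately show ?thesis by (simp add: layer_def)
qed

text \<open>
  The next layer is spanned by elements \<open>e_comp T \<curlywedge> e_comp Q'\<close> with \<open>length T + j < length Q\<close> and
  \<open>Q'\<close> a rearrangement of \<open>Q\<close>. Writing such an element as a commutator splits one component of \<open>T\<close>,
  so that it comes from an element one layer above, to which a difference of two rearrangements is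
  applied.
\<close>

lemma next_layer_generated:
  assumes N: "comb.subspace N"
    and gen: "\<And>R R' m. R \<in> set_compositions A \<Longrightarrow> R' \<in> set_compositions A \<Longrightarrow> set R = set R' \<Longrightarrow>
      m \<in> layer A Q j \<Longrightarrow> (basis R - basis R') \<curlywedge> m \<in> N"
  shows "layer A Q (Suc j) \<subseteq> (N :: 'f::field comb set)"
proof
  fix m :: "'f comb" assume m: "m \<in> layer A Q (Suc j)"
  then have mL: "m \<in> Lam A Q" by (simp add: layer_def)
  have "e_comp T \<curlywedge> m \<in> N" if T: "T \<in> ordered_set_compositions A" for T
  proof (cases "length Q < length T + Suc j \<or> \<not> Q \<preceq> T")
    case True
    then have "e_comp T \<curlywedge> m = 0"
      using m T e_comp_wedge_Lam_eq_0[OF ordered_is_composition[OF T] Q fin _ mL]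
      by (auto simp: layer_def)
    then show ?thesis by (simp add: comb.subspace_0[OF N])
  next
    case False
    have TA: "T \<in> set_compositions A" using T by (rule ordered_is_composition)
    have "e_comp T \<curlywedge> e_comp Q' \<in> N" if Q': "Q' \<in> set_compositions A" "set Q' = set Q" for Q'
    proof -
      have ref: "Q' \<preceq> T" using False refines_cong[OF Q'(2)] by simp
      have len: "length Q' = length Q"
        using length_set_compositions[OF Q] length_set_compositions[OF Q'(1)] Q'(2) by simp
      with False have "length T < length Q'" by simp
      then show ?thesis
      proof (rule e_comp_wedge_bracket[OF TA Q'(1) fin ref])
        assume "e_comp T \<curlywedge> e_comp Q' = (0 :: 'f comb)"
        then show ?thesis by (simp add: comb.subspace_0[OF N])
      next
        fix R' R'' assume R: "R' \<in> set_compositions A" "R'' \<in> set_compositions A" "set R' = set R''"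
          and len': "length R' = Suc (length T)"
          and eq: "e_comp T \<curlywedge> e_comp Q' = (basis R' - basis R'') \<curlywedge> (e_comp R' \<curlywedge> e_comp Q' :: 'f comb)"
        have "e_comp R' \<curlywedge> e_comp Q' \<in> (layer A Q j :: 'f comb set)"
          using False len' by (intro e_comp_wedge_in_layer R e_comp_in_Lam Q' Q fin) auto
        then show ?thesis unfolding eq by (rule gen[OF R])
      qed
    qed
    moreover have "m \<in> comb.span (e_comp ` {Q' \<in> set_compositions A. set Q' = set Q})"
      using Lam_subset_span[OF Q fin] mL by blast
    ultimately show ?thesis
    proof -
      assume *: "\<And>Q'. Q' \<in> set_compositions A \<Longrightarrow> set Q' = set Q \<Longrightarrow> e_comp T \<curlywedge> e_comp Q' \<in> N"
      assume "m \<in> comb.span (e_comp ` {Q' \<in> set_compositions A. set Q' = set Q})"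
      then show "e_comp T \<curlywedge> m \<in> N"
      proof (induction rule: comb.span_induct_alt)
        case base
        then show ?case by (simp add: comb.subspace_0[OF N])
      next
        case (step c x y)
        then show ?case
          using * by (auto simp: wedge_right.add wedge_right.scale
              intro!: comb.subspace_add[OF N] comb.subspace_scale[OF N])
      qed
    qed
  qed
  then have "(\<Sum>T \<in> ordered_set_compositions A. e_comp T \<curlywedge> m) \<in> N"
    by (intro comb.subspace_sum[OF N])
  then show "m \<in> N" using Lam_decomposition[OF Q fin mL] by simp
qed

end

section \<open>The radical of a layer\<close>

text \<open>
  Scalars act through the multiples of the identity of the algebra.
\<close>

lemma submodule_subspace:
  assumes "is_submodule (\<curlywedge>) (comp_algebra A) M N" "M \<subseteq> (comp_algebra A :: 'f::field comb set)"
  shows "comb.subspace N"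
proof -
  have N: "N \<subseteq> M" "0 \<in> N" "\<And>x y. x \<in> N \<Longrightarrow> y \<in> N \<Longrightarrow> x - y \<in> N"
    "\<And>r x. r \<in> comp_algebra A \<Longrightarrow> x \<in> N \<Longrightarrow> r \<curlywedge> x \<in> N"
    using assms(1) by (auto simp: is_submodule_def)
  show ?thesis
  proof (rule comb.subspaceI)
    show "0 \<in> N" by (rule N)
    fix x y :: "'f comb" and c assume xy: "x \<in> N" "y \<in> N"
    have "x - (0 - y) \<in> N" by (intro N xy)
    then show "x + y \<in> N" by simp
  next
    fix x :: "'f comb" and c assume x: "x \<in> N"
    then have "x \<in> comp_algebra A" using N(1) assms(2) by blast
    then have "scale c (comp_one A) \<curlywedge> x = scale c x"
      by (simp add: wedge_left.scale comp_one_wedge)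
    moreover have "scale c (comp_one A) \<curlywedge> x \<in> N"
      by (intro N(4) x comp_algebra_closed comp_one_in_comp_algebra)
    ultimately show "scale c x \<in> N" by simp
  qed
qed

context
  fixes A :: "nat set" and Q :: "nat set list"
  assumes fin: "finite A" and Q: "Q \<in> set_compositions A"
begin

lemma layer_subset: "layer A Q j \<subseteq> (comp_algebra A :: 'f::field comb set)"
  using Lam_subset[OF Q] by (auto simp: layer_def)

text \<open>
  Some \<open>e_comp T \<curlywedge> x\<close> with \<open>T\<close> of length \<open>length Q - j\<close> has a non-zero coordinate. That coordinate
  is a linear form on the layer whose kernel is a submodule because set compositions act on
  \<open>e_comp T \<curlywedge> m\<close> by \<open>1\<close> or \<open>0\<close>; it is maximal because it has codimension one.
\<close>

lemma maximal_submodule_avoiding: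
  assumes x: "x \<in> layer A Q j" "x \<notin> layer A Q (Suc j)"
  obtains N where "is_maximal_submodule (\<curlywedge>) (comp_algebra A) (layer A Q j) N"
    and "x \<notin> (N :: 'f::field comb set)"
proof -
  have "x \<in> Lam A Q" using x(1) by (simp add: layer_def)
  with x(2) obtain T where T: "T \<in> ordered_set_compositions A" "length Q < length T + Suc j"
    and nz: "e_comp T \<curlywedge> x \<noteq> 0"
    by (auto simp: layer_def)
  then obtain P\<^sub>0 where P0: "Poly_Mapping.lookup (e_comp T \<curlywedge> x) P\<^sub>0 \<noteq> 0"
    by (metis poly_mapping_eqI lookup_zero)
  define h :: "'f comb \<Rightarrow> 'f" where "h y = Poly_Mapping.lookup (e_comp T \<curlywedge> y) P\<^sub>0" for y
  have h_lin: "h (y - z) =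
      h y - h z" "h (y + z) = h y + h z" "h (scale c y) = c * h y" "h 0 = 0" for y z c
    by (simp_all add: h_def wedge_right.diff wedge_right.add wedge_right.scale lookup_minus lookup_add)
  define N where "N = {y \<in> layer A Q j. h y = 0}"
  have closed: "r \<curlywedge> y \<in> N" if "r \<in> comp_algebra A" "y \<in> N" for r y
    using that(1)
  proof (induction rule: comp_algebra_induct)
    case (basis P)
    have y: "y \<in> layer A Q j" "h y = 0" using that(2) by (auto simp: N_def)
    have "h (basis P \<curlywedge> y) = 0"
      using e_comp_wedge_basis_wedge_layer[OF fin Q T(1) basis y(1)] T(2) y(2) by (auto simp: h_def)
    moreover have "basis P \<curlywedge> y \<in> layer A Q j"
      using basis by (intro wedge_in_layer[OF fin Q] y) simp
    ultimately show ?case by (simp add: N_def)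
  qed (auto simp: N_def wedge_left.add wedge_left.scale h_lin layer_closed[OF fin Q])
  have sub: "is_submodule (\<curlywedge>) (comp_algebra A) (layer A Q j) N"
    unfolding is_submodule_def using closed
    by (auto simp: N_def h_lin layer_closed[OF fin Q])
  have xN: "x \<notin> N" using P0 by (simp add: N_def h_def)
  have "L = N \<or> L = layer A Q j"
    if L: "is_submodule (\<curlywedge>) (comp_algebra A) (layer A Q j) L" "N \<subseteq> L" for L
  proof (cases "L \<subseteq> N")
    case True
    with L show ?thesis by auto
  next
    case False
    have LM: "L \<subseteq> layer A Q j" using L(1) by (simp add: is_submodule_def)
    from False obtain z where z: "z \<in> L" "z \<notin> N" by blast
    with LM have hz: "h z \<noteq> 0" "z \<in> layer A Q j" by (auto simp: N_def)
    have Lsub: "comb.subspace L" by (rule submodule_subspace[OF L(1) layer_subset])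
    have "y \<in> L" if y: "y \<in> layer A Q j" for y
    proof -
      let ?z = "scale (h y / h z) z"
      have "y - ?z \<in> N"
        using y hz by (simp add: N_def h_lin layer_closed[OF fin Q])
      then have "(y - ?z) + ?z \<in> L"
        using L(2) z by (intro comb.subspace_add[OF Lsub] comb.subspace_scale[OF Lsub]) auto
      then show ?thesis by simp
    qed
    with LM show ?thesis by blast
  qed
  then have "is_maximal_submodule (\<curlywedge>) (comp_algebra A) (layer A Q j) N"
    unfolding is_maximal_submodule_def using sub xN x(1) by blast
  with xN show thesis using that by blast
qed

text \<open>
  A form of Nakayama's argument. Every \<open>N + layer A Q (j + i)\<close> is a submodule between \<open>N\<close> and
  \<open>layer A Q j\<close>, so it is one of the two. It is the whole layer for \<open>i = 0\<close> and \<open>N\<close> for large \<open>i\<close>,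
  and the last \<open>i\<close> before the change shows that the generators of the next layer lie in \<open>N\<close>.
\<close>

lemma next_layer_subset_maximal:
  assumes N: "is_maximal_submodule (\<curlywedge>) (comp_algebra A) (layer A Q j) N"
  shows "layer A Q (Suc j) \<subseteq> (N :: 'f::field comb set)"
proof -
  have sub: "is_submodule (\<curlywedge>) (comp_algebra A) (layer A Q j) N" and "N \<noteq> layer A Q j"
    and max: "\<And>L. is_submodule (\<curlywedge>) (comp_algebra A) (layer A Q j) L \<Longrightarrow> N \<subseteq> L \<Longrightarrow>
      L = N \<or> L = layer A Q j"
    using N by (auto simp: is_maximal_submodule_def)
  have NM: "N \<subseteq> layer A Q j" and closed: "\<And>r x. r \<in> comp_algebra A \<Longrightarrow> x \<in> N \<Longrightarrow> r \<curlywedge> x \<in> N"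
    using sub by (auto simp: is_submodule_def)
  have Nsub: "comb.subspace N" by (rule submodule_subspace[OF sub layer_subset])
  define L :: "nat \<Rightarrow> 'f comb set" where "L i = {a + b | a b. a \<in> N \<and> b \<in> layer A Q (j + i)}" for i
  have L_I: "a + b \<in> L i" if "a \<in> N" "b \<in> layer A Q (j + i)" for a b i
    unfolding L_def using that by blast
  have NL: "N \<subseteq> L i" for i
    using L_I[OF _ layer_closed(1)[OF fin Q]] by auto
  have layer_L: "layer A Q (j + i) \<subseteq> L i" for i
    using L_I[OF comb.subspace_0[OF Nsub]] by auto
  have L_sub: "is_submodule (\<curlywedge>) (comp_algebra A) (layer A Q j) (L i)" for i
  proof -
    have "comb.subspace (L i)"
      unfolding L_def by (rule comb.subspace_sums[OF Nsub subspace_layer[OF fin Q]])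
    moreover have "L i \<subseteq> layer A Q j"
      using NM layer_mono[OF fin Q, of j "j + i"] unfolding L_def
      by (auto intro!: layer_closed[OF fin Q])
    moreover have "r \<curlywedge> y \<in> L i" if "r \<in> comp_algebra A" "y \<in> L i" for r y
    proof -
      obtain a b where ab: "y = a + b" "a \<in> N" "b \<in> layer A Q (j + i)"
        using \<open>y \<in> L i\<close> unfolding L_def by blast
      show ?thesis
        unfolding ab(1) wedge_right.add
        by (intro L_I closed wedge_in_layer[OF fin Q] ab that(1))
    qed
    ultimately show ?thesis
      unfolding is_submodule_def by (auto intro: comb.subspace_0 comb.subspace_diff)
  qed
  have L_cases: "L i = N \<or> L i = layer A Q j" for i
    by (rule max[OF L_sub NL])
  have "L 0 = layer A Q j"
  proof -
    have "layer A Q j \<subseteq> L 0"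
      using layer_L[of 0] by simp
    then show ?thesis using L_sub[of 0] by (auto simp: is_submodule_def)
  qed
  then have L0: "L 0 \<noteq> N" using \<open>N \<noteq> layer A Q j\<close> by simp
  have "L (Suc (length Q)) = N"
    by (simp add: L_def layer_eq_0[OF fin Q])
  then obtain i where i: "L i \<noteq> N" "L (Suc i) = N"
    using L0 nat_induct[of "\<lambda>i. L i \<noteq> N" "Suc (length Q)"] by blast
  then have Li: "L i = layer A Q j" using L_cases by blast
  have low: "layer A Q (Suc (j + i)) \<subseteq> N"
    using layer_L[of "Suc i"] i(2) by simp
  have gen: "(basis R - basis R') \<curlywedge> m \<in> N"
    if R: "R \<in> set_compositions A" "R' \<in> set_compositions A" "set R = set R'"
      and m: "m \<in> layer A Q j" for R R' m
  proof -
    obtain a b where ab: "m = a + b" "a \<in> N" "b \<in> layer A Q (j + i)"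
      using m unfolding Li[symmetric] L_def by blast
    have "(basis R - basis R') \<curlywedge> a \<in> N"
      using R by (intro closed ab comp_algebra_closed) auto
    moreover have "(basis R - basis R') \<curlywedge> b \<in> N"
      using basis_diff_wedge_in_next_layer[OF fin Q R ab(3)] low by auto
    ultimately show ?thesis
      unfolding ab wedge_right.add by (rule comb.subspace_add[OF Nsub])
  qed
  show ?thesis by (rule next_layer_generated[OF fin Q Nsub gen])
qed

lemma module_rad_layer:
  "module_rad (\<curlywedge>) (comp_algebra A) (layer A Q j) = (layer A Q (Suc j) :: 'f::field comb set)"
proof
  show "module_rad (\<curlywedge>) (comp_algebra A) (layer A Q j) \<subseteq> (layer A Q (Suc j) :: 'f comb set)"
  proof
    fix x :: "'f comb" assume x: "x \<in> module_rad (\<curlywedge>) (comp_algebra A) (layer A Q j)"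
    show "x \<in> layer A Q (Suc j)"
    proof (rule ccontr)
      assume "x \<notin> layer A Q (Suc j)"
      moreover have "x \<in> layer A Q j" using x by (simp add: module_rad_def)
      ultimately obtain N where "is_maximal_submodule (\<curlywedge>) (comp_algebra A) (layer A Q j) N" "x \<notin> N"
        using maximal_submodule_avoiding by blast
      with x show False by (auto simp: module_rad_def)
    qed
  qed
  show "layer A Q (Suc j) \<subseteq> (module_rad (\<curlywedge>) (comp_algebra A) (layer A Q j) :: 'f comb set)"
    unfolding module_rad_def
    by (intro Int_greatest Inter_greatest layer_mono[OF fin Q])
       (simp_all add: next_layer_subset_maximal)
qed

lemma module_rad_iter_Lam:
  "module_rad_iter (\<curlywedge>) (comp_algebra A) k (Lam A Q) = (layer A Q k :: 'f::field comb set)"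
  by (induction k) (simp_all add: module_rad_iter_def layer_0[OF fin Q] module_rad_layer)

section \<open>Layers as sums and direct sums\<close>

lemma e_comp_image_subset_layer:
  assumes "R \<in> set_compositions A" "length R + k \<le> length Q"
  shows "(\<lambda>x. e_comp R \<curlywedge> x) ` Lam A Q \<subseteq> (layer A Q k :: 'f::field comb set)"
  using e_comp_wedge_in_layer[OF fin Q assms] by auto

lemma layer_eq_sum:
  "layer A Q k = (\<Sum>R | R \<in> set_compositions A \<and> Q \<preceq> R \<and> length R + k \<le> length Q.
      (\<lambda>x. e_comp R \<curlywedge> x) ` Lam A Q :: 'f::field comb set)"
    (is "_ = sum ?I ?R")
proof -
  have finR: "finite ?R" using finite_set_compositions[OF fin] by simp
  show ?thesis
    unfolding set_sum_alt[OF finR]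
  proof (intro equalityI subsetI)
    fix m :: "'f comb" assume m: "m \<in> layer A Q k"
    then have mL: "m \<in> Lam A Q" by (simp add: layer_def)
    \<comment> \<open>Every summand \<open>R\<close> needs an entry; the ordered ones suffice and the others get \<open>0\<close>.\<close>
    define s where "s R = e_comp R \<curlywedge> (if R \<in> ordered_set_compositions A then m else 0)" for R
    have "m = (\<Sum>T \<in> ordered_set_compositions A. e_comp T \<curlywedge> m)"
      by (rule Lam_decomposition[OF Q fin mL])
    also have "\<dots> = (\<Sum>T \<in> ordered_set_compositions A \<inter> ?R. e_comp T \<curlywedge> m)"
    proof (intro sum.mono_neutral_right finite_ordered[OF fin] ballI)
      fix T assume T: "T \<in> ordered_set_compositions A - ordered_set_compositions A \<inter> ?R"
      then have TA: "T \<in> set_compositions A" using ordered_is_composition by auto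
      with T consider "\<not> Q \<preceq> T" | "length Q < length T + k" by auto
      then show "e_comp T \<curlywedge> m = 0"
      proof cases
        case 1
        then show ?thesis by (rule e_comp_wedge_Lam_eq_0[OF TA Q fin _ mL])
      next
        case 2
        then show ?thesis using m T by (simp add: layer_def)
      qed
    qed auto
    also have "\<dots> = sum s ?R"
      using finR by (intro sum.mono_neutral_cong_left) (auto simp: s_def)
    finally have "m = sum s ?R" .
    moreover have "s R \<in> ?I R" for R
      unfolding s_def by (rule imageI) (simp add: mL comb.subspace_0[OF subspace_Lam])
    ultimately show "m \<in> {sum s ?R |s. \<forall>R \<in> ?R. s R \<in> ?I R}" by fast
  next
    fix m :: "'f comb" assume "m \<in> {sum s ?R |s. \<forall>R \<in> ?R. s R \<in> ?I R}"
    then obtain s where s: "m = sum s ?R" "\<And>R. R \<in> ?R \<Longrightarrow> s R \<in> ?I R" by blast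
    have "s R \<in> layer A Q k" if "R \<in> ?R" for R
      using s(2)[OF that] e_comp_image_subset_layer[of R k] that by blast
    then show "m \<in> layer A Q k"
      unfolding s(1) by (intro layer_closed[OF fin Q])
  qed
qed

lemma layer_direct_sum:
  defines "K k \<equiv> {T \<in> ordered_set_compositions A. Q \<preceq> T \<and> length T + k = length Q}"
  shows "is_direct_sum (insert None (Some ` K k))
    (\<lambda>i. case i of None \<Rightarrow> layer A Q (Suc k) | Some T \<Rightarrow> (\<lambda>x. e_comp T \<curlywedge> x) ` Lam A Q)
    (layer A Q k :: 'f::field comb set)"
proof -
  let ?S = "\<lambda>i. case i of None \<Rightarrow> layer A Q (Suc k) | Some T \<Rightarrow> ((\<lambda>x. e_comp T \<curlywedge> x) ` Lam A Q :: 'f comb set)"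
  let ?J = "insert None (Some ` K k)"
  have finK: "finite (K k)" using finite_ordered[OF fin] by (simp add: K_def)
  then have finJ: "finite ?J" by simp
  have sumJ: "sum x ?J = x None + (\<Sum>T \<in> K k. x (Some T))" for x :: "nat set list option \<Rightarrow> 'f comb"
    using finK by (simp add: sum.insert sum.reindex)
  have K: "T \<in> ordered_set_compositions A" "T \<in> set_compositions A" "length T + k = length Q"
    if "T \<in> K k" for T
    using that ordered_is_composition by (auto simp: K_def)
  have proj: "e_comp T \<curlywedge> (e_comp T' \<curlywedge> m) = (if T = T' then e_comp T \<curlywedge> m else 0 :: 'f comb)"
    if T: "T \<in> ordered_set_compositions A" "T' \<in> ordered_set_compositions A" for T T' m
  proof (cases "T = T'")
    case True
    note TA = ordered_is_composition[OF T(1)]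
    have "e_comp T \<curlywedge> e_comp T = (e_comp T :: 'f comb)"
      by (rule e_comp_wedge_same_blocks[OF TA TA fin refl])
    with True show ?thesis by (simp flip: wedge_assoc)
  next
    case False
    have "e_comp T \<curlywedge> e_comp T' = (0 :: 'f comb)"
      by (rule e_comp_orthogonal[OF T fin False])
    with False show ?thesis by (simp flip: wedge_assoc)
  qed
  have "layer A Q k = sum ?S ?J"
    unfolding set_sum_alt[OF finJ]
  proof (intro equalityI subsetI)
    fix m :: "'f comb" assume m: "m \<in> layer A Q k"
    then have mL: "m \<in> Lam A Q" by (simp add: layer_def)
    \<comment> \<open>The part of \<open>m\<close> in the next layer is what the idempotents of length \<open>length Q - k\<close> leave.\<close>
    define r where "r = m - (\<Sum>T \<in> K k. e_comp T \<curlywedge> m)"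
    have "r \<in> layer A Q (Suc k)"
    proof -
      have "r \<in> Lam A Q"
        unfolding r_def
        by (intro comb.subspace_diff[OF subspace_Lam] comb.subspace_sum[OF subspace_Lam] mL
            wedge_in_Lam e_comp_in_comp_algebra K)
      moreover have "e_comp T \<curlywedge> r = 0"
        if T: "T \<in> ordered_set_compositions A" "length Q < length T + Suc k" for T
      proof -
        have "e_comp T \<curlywedge> r = e_comp T \<curlywedge> m - (\<Sum>T' \<in> K k. if T = T' then e_comp T \<curlywedge> m else 0)"
          unfolding r_def wedge_right.diff wedge_right.sum using proj[OF T(1)] K(1) by simp
        also have "\<dots> = (if T \<in> K k then 0 else e_comp T \<curlywedge> m)"
          using finK by simp
        also have "\<dots> = 0"
        proof (cases "T \<in> K k")
          case False
          with T consider "\<not> Q \<preceq> T" | "length Q < length T + k" by (auto simp: K_def)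
          then have "e_comp T \<curlywedge> m = 0"
          proof cases
            case 1
            then show ?thesis
                by (rule e_comp_wedge_Lam_eq_0[OF ordered_is_composition[OF T(1)] Q fin _ mL])
          next
            case 2
            then show ?thesis using m T by (simp add: layer_def)
          qed
          then show ?thesis by simp
        qed simp
        finally show ?thesis .
      qed
      ultimately show ?thesis by (simp add: layer_def)
    qed
    then have "\<forall>i \<in> ?J. (case i of None \<Rightarrow> r | Some T \<Rightarrow> e_comp T \<curlywedge> m) \<in> ?S i"
      using mL by auto
    moreover have "m = sum (\<lambda>i. case i of None \<Rightarrow> r | Some T \<Rightarrow> e_comp T \<curlywedge> m) ?J"
      unfolding sumJ by (simp add: r_def)
    ultimately show "m \<in> {sum s ?J |s. \<forall>i \<in> ?J. s i \<in> ?S i}" by blast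
  next
    fix m :: "'f comb" assume "m \<in> {sum s ?J |s. \<forall>i \<in> ?J. s i \<in> ?S i}"
    then obtain s where s: "m = sum s ?J" "\<And>i. i \<in> ?J \<Longrightarrow> s i \<in> ?S i" by blast
    have "s None \<in> layer A Q k"
      using s(2)[of None] layer_mono[OF fin Q, of k "Suc k"] by auto
    moreover have "s (Some T) \<in> layer A Q k" if "T \<in> K k" for T
      using s(2)[of "Some T"] e_comp_image_subset_layer[of T k] K[OF that] that by auto
    ultimately show "m \<in> layer A Q k"
      unfolding s(1) sumJ by (intro layer_closed[OF fin Q])
  qed
  moreover have "\<forall>i \<in> ?J. x i = 0" if x: "\<forall>i \<in> ?J. x i \<in> ?S i" "sum x ?J = 0" for x
  proof -
    have "x (Some T) = 0" if T: "T \<in> K k" for T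
    proof -
      have "e_comp T \<curlywedge> x None = 0"
        using x(1) K[OF T] by (auto simp: layer_def)
      moreover have "e_comp T \<curlywedge> x (Some T') = (if T = T' then x (Some T) else 0)"
          if T': "T' \<in> K k" for T'
      proof -
        obtain m where "x (Some T') = e_comp T' \<curlywedge> m" using x(1) T' by auto
        then show ?thesis using proj[OF K(1)[OF T] K(1)[OF T'], of m] by auto
      qed
      ultimately have "e_comp T \<curlywedge> sum x ?J = x (Some T)"
        unfolding sumJ wedge_right.add wedge_right.sum using finK T by simp
      with x(2) show ?thesis by simp
    qed
    with x(2) show ?thesis unfolding sumJ by auto
  qed
  ultimately show ?thesis
    unfolding is_direct_sum_def using finJ by blast
qed

end

theorem theorem7p2:
  fixes A :: "nat set" and Q :: "nat set list" and k :: nat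
  assumes "finite A" and "A \<subseteq> {1..}"
    and "Q \<in> ordered_set_compositions A"
  shows
    "module_rad_iter wedge (comp_algebra A) k (Lam A Q :: (nat set list \<Rightarrow>\<^sub>0 'f::field) set) =
       (\<Sum>R | R \<in> set_compositions A \<and> Q \<preceq> R \<and> int (length Q) - int (length R) \<ge> int k.
          (\<lambda>x. e_comp R \<curlywedge> x) ` Lam A Q) \<and>
     is_direct_sum
       (insert None (Some ` {T. T \<in> ordered_set_compositions A \<and> Q \<preceq> T \<and>
                                int (length Q) - int (length T) = int k}))
       (\<lambda>i. case i of
              None \<Rightarrow> module_rad_iter wedge (comp_algebra A) (Suc k) (Lam A Q)
            | Some T \<Rightarrow> (\<lambda>x. e_comp T \<curlywedge> x) ` Lam A Q)
       (module_rad_iter wedge (comp_algebra A) k (Lam A Q :: (nat set list \<Rightarrow>\<^sub>0 'f) set))"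
proof -
  have Q: "Q \<in> set_compositions A" using assms(3) by (rule ordered_is_composition)
  have "int (length Q) - int (length R) \<ge> int k \<longleftrightarrow> length R + k \<le> length Q"
    "int (length Q) - int (length R) = int k \<longleftrightarrow> length R + k = length Q" for R :: "nat set list"
    by linarith+
  then show ?thesis
    unfolding module_rad_iter_Lam[OF assms(1) Q]
    by (simp only: layer_eq_sum[OF assms(1) Q, symmetric] layer_direct_sum[OF assms(1) Q]
        simp_thms)
qed

end
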